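(* For all $\varepsilon\in[0,1)$: $\mathsf{WWKL}^\Delta\equiv_W\varepsilon\text{-}\mathsf{WWKL}*\mathsf{C}_\mathbb{N}$.
   Context: A represented space is a pair $(X,\delta_X)$ with $\delta_X:\subseteq\mathbb{N}^\mathbb{N}\to X$ a partial surjection. A realizer of $f:\subseteq X\rightrightarrows Y$ is a partial $F$ with $\delta_Y F(p)\in f(\delta_X(p))$ for all $p\in\mathrm{dom}(f\circ\delta_X)$. $f\le_W g$ if there are computable partial $H,K:\subseteq\mathbb{N}^\mathbb{N}\to\mathbb{N}^\mathbb{N}$ such that $p\mapsto H\langle p,GK(p)\rangle$ realizes $f$ for every realizer $G$ of $g$; $\equiv_W$ is the induced equivalence. The compositional product $f*g$ is the Weihrauch degree which is the maximum with respect to $\le_W$ of all compositions $f_0\circ g_0$ with $f_0\le_W f$ and $g_0\le_W g$ (it exists). $\mathsf C_\mathbb N$: given a nonempty $A\subseteq\mathbb N$ via an enumeration of $\mathbb N\setminus A$, output some element of $A$. $\mathrm{Tr}$ is the set of binary trees $T\subseteq\{0,1\}^*$, represented by characteristic functions; $[T]$ its set of infinite paths; $\mu$ the uniform measure on $2^\mathbb N$. $\mathsf{WWKL}:\subseteq\mathrm{Tr}\rightrightarrows2^\mathbb N$, $T\mapsto[T]$, has domain $\{T:\mu([T])>0\}$; $\varepsilon\text{-}\mathsf{WWKL}$ is its restriction to $\{T:\mu([T])>\varepsilon\}$. Discrete jump: $\lim_\Delta$ maps $\langle p_0,p_1,\dots\rangle$ (with $\langle p_0,p_1,\dots\rangle\langle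 i,j\rangle=p_i(j)$) to $\lim_ip_i$, restricted to eventually constant sequences $(p_i)$. The discrete jump $f^\Delta$ of $f:\subseteq(X,\delta_X)\rightrightarrows(Y,\delta_Y)$ is the same multi-valued function with input representation $\delta_X\circ\lim_\Delta$. *)

theory Defs
  imports "HOL-Probability.Probability" "HOL-Library.Nat_Bijection"
begin

datatype recf = Zr | Sc | Proj nat | Comp recf "recf list" | Prim recf recf | Mn recf

inductive rf_eval :: "recf \<Rightarrow> nat list \<Rightarrow> nat \<Rightarrow> bool" where
  zero: "rf_eval Zr xs 0"
| succ: "rf_eval Sc (x # xs) (Suc x)"
| proj: "i < length xs \<Longrightarrow> rf_eval (Proj i) xs (xs ! i)"
| comp: "length ys = length gs \<Longrightarrow> (\<forall>i < length gs. rf_eval (gs ! i) xs (ys ! i))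
           \<Longrightarrow> rf_eval f ys z \<Longrightarrow> rf_eval (Comp f gs) xs z"
| prim0: "rf_eval f xs y \<Longrightarrow> rf_eval (Prim f g) (0 # xs) y"
| primS: "rf_eval (Prim f g) (n # xs) y \<Longrightarrow> rf_eval g (n # y # xs) z
           \<Longrightarrow> rf_eval (Prim f g) (Suc n # xs) z"
| mn: "rf_eval f (n # xs) 0 \<Longrightarrow> (\<forall>m < n. \<exists>y. rf_eval f (m # xs) y \<and> 0 < y)
           \<Longrightarrow> rf_eval (Mn f) xs n"

definition total_recursive :: "(nat \<Rightarrow> nat) \<Rightarrow> bool" where
  "total_recursive a \<longleftrightarrow> (\<exists>c. \<forall>x. rf_eval c [x] (a x))"

type_synonym baire = "nat \<Rightarrow> nat"

definition pref :: "baire \<Rightarrow> nat \<Rightarrow> nat list" where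
  "pref p k = map p [0..<k]"

text \<open>Computability of a partial F via an associate (Kleene-style): a total recursive
  alpha such that for p in dom F and every n, the first prefix p[k] with
  alpha(n, code of p[k]) > 0 yields F(p)(n) + 1.\<close>
definition assoc_val :: "(nat \<Rightarrow> nat) \<Rightarrow> baire \<Rightarrow> nat \<Rightarrow> nat \<Rightarrow> nat" where
  "assoc_val a p n k = a (prod_encode (n, list_encode (pref p k)))"

definition computable_pf :: "(baire \<Rightarrow> baire option) \<Rightarrow> bool" where
  "computable_pf F \<longleftrightarrow> (\<exists>a. total_recursive a \<and>
     (\<forall>p q. F p = Some q \<longrightarrow>
        (\<forall>n. (\<exists>k. 0 < assoc_val a p n k) \<and>
             q n = assoc_val a p n (LEAST k. 0 < assoc_val a p n k) - 1)))"

definition pair_b :: "baire \<Rightarrow> baire \<Rightarrow> baire" where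
  "pair_b p q = (\<lambda>n. if even n then p (n div 2) else q (n div 2))"

type_synonym 'a rep = "baire \<Rightarrow> 'a option"

definition rep_space :: "'a rep \<Rightarrow> bool" where
  "rep_space \<delta> \<longleftrightarrow> (\<forall>x. \<exists>p. \<delta> p = Some x)"

text \<open>A problem: input representation, output representation, multi-valued map
  (domain = points with nonempty value set).\<close>
type_synonym ('a, 'b) problem = "'a rep \<times> 'b rep \<times> ('a \<Rightarrow> 'b set)"

definition is_problem :: "('a, 'b) problem \<Rightarrow> bool" where
  "is_problem P \<longleftrightarrow> rep_space (fst P) \<and> rep_space (fst (snd P))"

definition realizes :: "('a, 'b) problem \<Rightarrow> (baire \<Rightarrow> baire option) \<Rightarrow> bool" where
  "realizes P F \<longleftrightarrow> (case P of (\<delta>X, \<delta>Y, f) \<Rightarrow>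
     (\<forall>p x. \<delta>X p = Some x \<and> f x \<noteq> {} \<longrightarrow>
        (\<exists>q y. F p = Some q \<and> \<delta>Y q = Some y \<and> y \<in> f x)))"

definition W_le :: "('a, 'b) problem \<Rightarrow> ('c, 'd) problem \<Rightarrow> bool" (infix "\<le>\<^sub>W" 50) where
  "P \<le>\<^sub>W Q \<longleftrightarrow> (\<exists>H K. computable_pf H \<and> computable_pf K \<and>
     (\<forall>G. realizes Q G \<longrightarrow>
        realizes P (\<lambda>p. Option.bind (K p) (\<lambda>k. Option.bind (G k) (\<lambda>r. H (pair_b p r))))))"

definition W_eq :: "('a, 'b) problem \<Rightarrow> ('c, 'd) problem \<Rightarrow> bool" (infix "\<equiv>\<^sub>W" 50) where
  "P \<equiv>\<^sub>W Q \<longleftrightarrow> P \<le>\<^sub>W Q \<and> Q \<le>\<^sub>W P"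

definition mv_comp :: "('x \<Rightarrow> 'y set) \<Rightarrow> ('u \<Rightarrow> 'x set) \<Rightarrow> 'u \<Rightarrow> 'y set" where
  "mv_comp f g u = (if (\<forall>x \<in> g u. f x \<noteq> {}) then \<Union>(f ` g u) else {})"

definition comp_problem :: "('x, 'y) problem \<Rightarrow> ('u, 'x) problem \<Rightarrow> ('u, 'y) problem" where
  "comp_problem F G = (fst G, fst (snd F), mv_comp (snd (snd F)) (snd (snd G)))"

definition composable :: "('x, 'y) problem \<Rightarrow> ('u, 'x) problem \<Rightarrow> bool" where
  "composable F G \<longleftrightarrow> fst (snd G) = fst F"

text \<open>P \<equiv>W f * g, where f*g is the max of all compositions f0 o g0 with f0 \<le>W f, g0 \<le>W g.
  Upper-bound part: over all represented spaces of the types 'u,'x,'y (these are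
  type parameters, universally quantified at the theorem level). Attainment part:
  a composition on Baire-typed spaces (every represented space is equivalent to one).\<close>
definition W_eq_comp_prod ::
  "('a, 'b) problem \<Rightarrow> ('c, 'd) problem \<Rightarrow> ('e, 'h) problem
     \<Rightarrow> 'u itself \<Rightarrow> 'x itself \<Rightarrow> 'y itself \<Rightarrow> bool" where
  "W_eq_comp_prod P f g TYPE('u) TYPE('x) TYPE('y) \<longleftrightarrow>
     (\<forall>(f0 :: ('x, 'y) problem) (g0 :: ('u, 'x) problem).
        is_problem f0 \<and> is_problem g0 \<and> composable f0 g0 \<and> f0 \<le>\<^sub>W f \<and> g0 \<le>\<^sub>W g
        \<longrightarrow> comp_problem f0 g0 \<le>\<^sub>W P)
   \<and> (\<exists>(f0 :: (baire, baire) problem) (g0 :: (baire, baire) problem).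
        is_problem f0 \<and> is_problem g0 \<and> composable f0 g0 \<and> f0 \<le>\<^sub>W f \<and> g0 \<le>\<^sub>W g
        \<and> P \<le>\<^sub>W comp_problem f0 g0)"

fun bl_code :: "bool list \<Rightarrow> nat" where
  "bl_code [] = 0"
| "bl_code (b # w) = Suc (2 * bl_code w + (if b then 1 else 0))"

definition is_tree :: "bool list set \<Rightarrow> bool" where
  "is_tree T \<longleftrightarrow> (\<forall>w n. w \<in> T \<longrightarrow> take n w \<in> T)"

definition delta_Tr :: "bool list set rep" where
  "delta_Tr p = (if (\<forall>n. p n \<le> 1) \<and> is_tree {w. p (bl_code w) = 1}
                 then Some {w. p (bl_code w) = 1} else None)"

definition delta_Cantor :: "(nat \<Rightarrow> bool) rep" where
  "delta_Cantor p = (if (\<forall>n. p n \<le> 1) then Some (\<lambda>n. p n = 1) else None)"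

definition paths :: "bool list set \<Rightarrow> (nat \<Rightarrow> bool) set" where
  "paths T = {x. \<forall>n. map x [0..<n] \<in> T}"

definition mu_Cantor :: "(nat \<Rightarrow> bool) measure" where
  "mu_Cantor = PiM UNIV (\<lambda>_. measure_pmf (bernoulli_pmf (1/2)))"

definition eps_WWKL :: "real \<Rightarrow> (bool list set, nat \<Rightarrow> bool) problem" where
  "eps_WWKL \<epsilon> = (delta_Tr, delta_Cantor,
     (\<lambda>T. if measure mu_Cantor (paths T) > \<epsilon> then paths T else {}))"

definition WWKL :: "(bool list set, nat \<Rightarrow> bool) problem" where
  "WWKL = (delta_Tr, delta_Cantor,
     (\<lambda>T. if measure mu_Cantor (paths T) > 0 then paths T else {}))"

definition delta_compl_enum :: "nat set rep" where
  "delta_compl_enum p = Some {n. \<forall>k. p k \<noteq> Suc n}"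

definition delta_nat :: "nat rep" where
  "delta_nat p = Some (p 0)"

definition C_N :: "(nat set, nat) problem" where
  "C_N = (delta_compl_enum, delta_nat, (\<lambda>A. A))"

definition seq_of :: "baire \<Rightarrow> nat \<Rightarrow> baire" where
  "seq_of r i = (\<lambda>j. r (prod_encode (i, j)))"

definition lim_Delta :: "baire \<Rightarrow> baire option" where
  "lim_Delta r = (if \<exists>N. \<forall>i\<ge>N. seq_of r i = seq_of r N
                  then Some (seq_of r (SOME N. \<forall>i\<ge>N. seq_of r i = seq_of r N)) else None)"

definition djump :: "('a, 'b) problem \<Rightarrow> ('a, 'b) problem" where
  "djump P = (case P of (\<delta>X, \<delta>Y, f) \<Rightarrow> ((\<lambda>r. Option.bind (lim_Delta r) \<delta>X), \<delta>Y, f))"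

end

theory Submission
  imports Defs
begin

text \<open>
  A composition \<open>f0 \<circ> g0\<close> with \<open>g0 \<le>\<^sub>W C_N\<close> needs one natural number, which can be guessed
  with finitely many mind changes; the tree computed from the guess is therefore available as a
  discrete limit. The outer reduction needs the guessed number \<open>n\<close> again, so the tree is grafted
  onto \<open>0\<^sup>n1\<close>, which keeps its measure positive and writes \<open>n\<close> into every path.

  Conversely, let \<open>r\<close> converge discretely to a tree \<open>T\<close> of positive measure. Both stabilisation
  of \<open>r\<close> from stage \<open>N\<close> on and the property that every level of the subtree at \<open>w\<close> is filled up
  to a fraction of at least \<open>1 - 1 / 2 ^ m > \<epsilon>\<close> are co-enumerable in \<open>r\<close>, and by a density argument
  some pair \<open>(N, w)\<close> has both properties. So \<open>C_N\<close> finds such a pair, and a path through the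
  subtree at \<open>w\<close>, prefixed by \<open>w\<close>, is a path of \<open>T\<close>.
\<close>

section \<open>Primitive recursive closure\<close>

text \<open>Two obstacles shape the proof. First, \<open>\<epsilon>\<close> is an arbitrary real, so
  no algorithm can compare anything with it. Only a natural number \<open>m\<close> with
  \<open>(1 / 2) ^ m < 1 - \<epsilon>\<close> enters the functionals: the test on a level then
  compares integers, and a measure of at least \<open>1 - (1 / 2) ^ m\<close> is strictly above
  \<open>\<epsilon>\<close>. Positive measure alone gives no such bound, whence the passage to a
  dense subtree. Second, a wrong guess may lead the given reductions outside their domains, where
  they need not halt, although an input of the jump must have all entries of all its stages defined.
  Guessing the least number not yet enumerated repairs this: every guess other than the final one is
  abandoned after finitely many steps, so each stage can wait until its entry is computed or its
  guess is abandoned.\<close>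

definition recursive_on :: "nat \<Rightarrow> (nat list \<Rightarrow> nat) \<Rightarrow> bool" where
  "recursive_on k f \<longleftrightarrow> (\<exists>c. \<forall>xs. length xs = k \<longrightarrow> rf_eval c xs (f xs))"

lemma recursive_on_nth: "i < k \<Longrightarrow> recursive_on k (\<lambda>xs. xs ! i)"
  unfolding recursive_on_def by (metis rf_eval.proj)

lemma recursive_on_comp:
  assumes f: "recursive_on (length gs) f" and gs: "\<And>g. g \<in> set gs \<Longrightarrow> recursive_on k g"
  shows "recursive_on k (\<lambda>xs. f (map (\<lambda>g. g xs) gs))"
proof -
  obtain c where c: "\<And>xs. length xs = length gs \<Longrightarrow> rf_eval c xs (f xs)"
    using f unfolding recursive_on_def by blast
  obtain d where d: "\<And>g xs. g \<in> set gs \<Longrightarrow> length xs = k \<Longrightarrow> rf_eval (d g) xs (g xs)"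
    using gs unfolding recursive_on_def by metis
  have "rf_eval (Comp c (map d gs)) xs (f (map (\<lambda>g. g xs) gs))" if "length xs = k" for xs
    by (rule rf_eval.comp[where ys = "map (\<lambda>g. g xs) gs"]) (auto intro!: c d that)
  then show ?thesis unfolding recursive_on_def by blast
qed

lemma recursive_on_comp1:
  "recursive_on 1 f \<Longrightarrow> recursive_on k g \<Longrightarrow> recursive_on k (\<lambda>xs. f [g xs])"
  using recursive_on_comp[of "[g]" f k] by simp

lemma recursive_on_comp2:
  "recursive_on 2 f \<Longrightarrow> recursive_on k g \<Longrightarrow> recursive_on k h \<Longrightarrow> recursive_on k (\<lambda>xs. f [g xs, h xs])"
  using recursive_on_comp[of "[g, h]" f k] by (simp add: numeral_2_eq_2) blast

lemma recursive_on_comp3: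
  "recursive_on 3 f \<Longrightarrow> recursive_on k g \<Longrightarrow> recursive_on k h \<Longrightarrow> recursive_on k l \<Longrightarrow>
    recursive_on k (\<lambda>xs. f [g xs, h xs, l xs])"
  using recursive_on_comp[of "[g, h, l]" f k] by (simp add: numeral_3_eq_3) blast

lemma recursive_on_0: "recursive_on k (\<lambda>xs. 0)"
  unfolding recursive_on_def by (metis rf_eval.zero)

lemma recursive_on_Suc: assumes "recursive_on k f" shows "recursive_on k (\<lambda>xs. Suc (f xs))"
proof -
  have "recursive_on 1 (\<lambda>xs. Suc (hd xs))"
    unfolding recursive_on_def
    by (rule exI[of _ Sc]) (auto simp: length_Suc_conv intro: rf_eval.succ)
  from recursive_on_comp1[OF this assms] show ?thesis by simp
qed

lemma recursive_on_const: "recursive_on k (\<lambda>xs. n)"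
  by (induction n) (auto intro: recursive_on_0 recursive_on_Suc)

lemma recursive_on_prim:
  assumes "recursive_on k f" "recursive_on (Suc (Suc k)) g"
  shows "recursive_on (Suc k) (\<lambda>xs. rec_nat (f (tl xs)) (\<lambda>n y. g (n # y # tl xs)) (hd xs))"
proof -
  obtain c where c: "\<And>xs. length xs = k \<Longrightarrow> rf_eval c xs (f xs)"
    using assms(1) unfolding recursive_on_def by blast
  obtain d where d: "\<And>xs. length xs = Suc (Suc k) \<Longrightarrow> rf_eval d xs (g xs)"
    using assms(2) unfolding recursive_on_def by blast
  have "rf_eval (Prim c d) (n # xs) (rec_nat (f xs) (\<lambda>n y. g (n # y # xs)) n)"
    if "length xs = k" for n xs
  proof (induction n)
    case 0
    show ?case using that by (auto intro: rf_eval.prim0 c)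
  next
    case (Suc n)
    show ?case by simp (rule rf_eval.primS[OF Suc], rule d, simp add: that)
  qed
  then have "rf_eval (Prim c d) xs (rec_nat (f (tl xs)) (\<lambda>n y. g (n # y # tl xs)) (hd xs))"
    if "length xs = Suc k" for xs
    using that by (cases xs) auto
  then show ?thesis unfolding recursive_on_def by blast
qed

lemma recursive_on_1: "recursive_on 1 (\<lambda>xs. f (hd xs)) \<longleftrightarrow> total_recursive f"
proof
  assume "recursive_on 1 (\<lambda>xs. f (hd xs))"
  then obtain c where c: "\<And>xs. length xs = 1 \<Longrightarrow> rf_eval c xs (f (hd xs))"
    unfolding recursive_on_def by blast
  have "rf_eval c [x] (f x)" for x using c[of "[x]"] by simp
  then show "total_recursive f" unfolding total_recursive_def by blast
next
  assume "total_recursive f"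
  then obtain c where "\<And>x. rf_eval c [x] (f x)" unfolding total_recursive_def by blast
  then have "rf_eval c xs (f (hd xs))" if "length xs = 1" for xs
    using that by (cases xs) auto
  then show "recursive_on 1 (\<lambda>xs. f (hd xs))" unfolding recursive_on_def by blast
qed

lemma recursive_on_total_recursive:
  "total_recursive f \<Longrightarrow> recursive_on k g \<Longrightarrow> recursive_on k (\<lambda>xs. f (g xs))"
  using recursive_on_comp1[of "\<lambda>xs. f (hd xs)" k g] unfolding recursive_on_1 by simp

text \<open>\<open>Prim\<close> recurses on its first argument; substituting \<open>h\<close> there
  and projections elsewhere allows a computed recursion depth while all parameters stay visible to
  the step.\<close>

lemma recursive_on_rec:
  assumes "recursive_on k f" "recursive_on k h"
    and g: "recursive_on (Suc (Suc k)) (\<lambda>xs. g (xs ! 0) (xs ! 1) (drop 2 xs))"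
  shows "recursive_on k (\<lambda>xs. rec_nat (f xs) (\<lambda>n y. g n y xs) (h xs))"
proof -
  let ?P = "\<lambda>xs. rec_nat (f (tl xs)) (\<lambda>n y. g n y (tl xs)) (hd xs)"
  have P: "recursive_on (Suc k) ?P"
    using recursive_on_prim[OF assms(1) g] by (simp add: numeral_2_eq_2)
  let ?gs = "h # map (\<lambda>i xs. xs ! i) [0..<k]"
  have "recursive_on k (\<lambda>xs. ?P (map (\<lambda>g. g xs) ?gs))"
    by (rule recursive_on_comp) (auto simp: P intro: assms(2) recursive_on_nth)
  moreover have "map (\<lambda>i. xs ! i) [0..<k] = xs" if "length xs = k" for xs :: "nat list"
    using that map_nth by blast
  ultimately show ?thesis unfolding recursive_on_def by (auto simp: comp_def)
qed

lemma recursive_on_rec_param: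
  assumes "recursive_on k f" "recursive_on k h" and g: "recursive_on 3 (\<lambda>xs. g (xs ! 0) (xs ! 1) (xs ! 2))"
    and c: "recursive_on k c"
  shows "recursive_on k (\<lambda>xs. rec_nat (f xs) (\<lambda>n y. g n y (c xs)) (h xs))"
proof (rule recursive_on_rec[OF assms(1,2)])
  let ?gs = "[\<lambda>xs. xs ! 0, \<lambda>xs. xs ! 1]"
  have "recursive_on (Suc (Suc k)) (\<lambda>xs. c (drop 2 xs))"
  proof -
    let ?gs = "map (\<lambda>i xs. xs ! (i + 2)) [0..<k]"
    have "recursive_on (Suc (Suc k)) (\<lambda>xs. c (map (\<lambda>g. g xs) ?gs))"
      by (rule recursive_on_comp) (auto simp: c intro: recursive_on_nth)
    moreover have "map (\<lambda>i. xs ! (i + 2)) [0..<k] = drop 2 xs" if "length xs = Suc (Suc k)" for xs :: "nat list"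
      using that by (intro nth_equalityI) (auto simp: add.commute)
    ultimately show ?thesis unfolding recursive_on_def by (auto simp: comp_def)
  qed
  then show "recursive_on (Suc (Suc k)) (\<lambda>xs. g (xs ! 0) (xs ! 1) (c (drop 2 xs)))"
    using recursive_on_comp3[OF g, of "Suc (Suc k)" "\<lambda>xs. xs ! 0" "\<lambda>xs. xs ! 1"]
    by (simp add: recursive_on_nth)
qed

section \<open>Arithmetic and the Cantor pairing function\<close>

lemma recursive_on_add:
  assumes "recursive_on k f" "recursive_on k g" shows "recursive_on k (\<lambda>xs. f xs + g xs)"
proof -
  have eq: "m + n = rec_nat m (\<lambda>_ y. Suc y) n" for m n :: nat by (induction n) auto
  show ?thesis unfolding eq
    by (rule recursive_on_rec[OF assms]) (intro recursive_on_Suc recursive_on_nth, simp)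
qed

lemma recursive_on_diff:
  assumes "recursive_on k f" "recursive_on k g" shows "recursive_on k (\<lambda>xs. f xs - g xs)"
proof -
  have p: "n - 1 = rec_nat 0 (\<lambda>m y. m) n" for n :: nat by (cases n) auto
  have eq: "m - n = rec_nat m (\<lambda>_ y. y - 1) n" for m n :: nat by (induction n) auto
  have "recursive_on l (\<lambda>xs. h xs - 1)" if "recursive_on l h" for l h
    unfolding p by (rule recursive_on_rec[OF recursive_on_0 that]) (intro recursive_on_nth, simp)
  then have "recursive_on k (\<lambda>xs. rec_nat (f xs) (\<lambda>_ y. y - 1) (g xs))"
    by (intro recursive_on_rec[OF assms]) (simp add: recursive_on_nth)
  then show ?thesis by (simp only: eq[symmetric])
qed

lemma recursive_on_rec_closed:
  assumes "recursive_on 2 (\<lambda>xs. g (xs ! 0) (xs ! 1))" "recursive_on k h"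
  shows "recursive_on k (\<lambda>xs. rec_nat c g (h xs))"
  using recursive_on_comp2[OF assms(1) recursive_on_nth recursive_on_nth, of 0 "Suc (Suc k)" 1]
  by (intro recursive_on_rec[OF recursive_on_const assms(2)]) simp

lemma recursive_on_mult:
  assumes "recursive_on k f" "recursive_on k g" shows "recursive_on k (\<lambda>xs. f xs * g xs)"
proof -
  have eq: "m * n = rec_nat 0 (\<lambda>i y. y + m) n" for m n :: nat by (induction n) auto
  show ?thesis unfolding eq
    by (rule recursive_on_rec_param[OF recursive_on_0 assms(2) _ assms(1)])
      (intro recursive_on_add recursive_on_nth; simp)
qed

lemma recursive_on_if0:
  assumes "recursive_on k f" "recursive_on k g" "recursive_on k h"
  shows "recursive_on k (\<lambda>xs. if f xs = 0 then g xs else h xs)"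
proof -
  \<comment> \<open>Under truncated subtraction \<open>1 - m\<close> is 1 for \<open>m = 0\<close>
    and 0 otherwise, so the case distinction is a weighted sum.\<close>
  have eq: "(if m = 0 then a else b) = (1 - m) * a + (1 - (1 - m)) * b" for m a b :: nat
    by (cases m) auto
  show ?thesis unfolding eq
    by (intro recursive_on_add recursive_on_mult recursive_on_diff recursive_on_const assms)
qed

lemma recursive_on_triangle:
  assumes "recursive_on k f" shows "recursive_on k (\<lambda>xs. triangle (f xs))"
proof -
  have eq: "triangle = rec_nat 0 (\<lambda>i y. y + Suc i)"
  proof
    show "triangle n = rec_nat 0 (\<lambda>i y. y + Suc i) n" for n by (induction n) auto
  qed
  show ?thesis unfolding eq
    by (intro recursive_on_rec_closed[OF _ assms] recursive_on_add recursive_on_Suc recursive_on_nth) auto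
qed

lemma recursive_on_prod_encode:
  assumes "recursive_on k f" "recursive_on k g"
  shows "recursive_on k (\<lambda>xs. prod_encode (f xs, g xs))"
  by (simp add: prod_encode_def recursive_on_add recursive_on_triangle assms)

text \<open>The inverse of \<open>triangle\<close>, rounded down. Primitive recursion suffices
  because the root grows by at most one when its argument grows by one.\<close>

definition triangle_root :: "nat \<Rightarrow> nat" where
  "triangle_root = rec_nat 0 (\<lambda>n y. if triangle (Suc y) - Suc n = 0 then Suc y else y)"

lemma triangle_root: "triangle (triangle_root n) \<le> n \<and> n < triangle (Suc (triangle_root n))"
  by (induction n) (auto simp: triangle_root_def)

lemma triangle_mono: "m \<le> n \<Longrightarrow> triangle m \<le> triangle n"
  unfolding triangle_def by (intro div_le_mono mult_le_mono) auto

text \<open>The code is \<open>triangle (m + n) + m\<close>, and the next triangular number is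
  \<open>m + n + 1\<close> further than \<open>triangle (m + n)\<close>, out of reach of the summand
  \<open>m\<close>.\<close>

lemma triangle_root_prod_encode: "triangle_root (prod_encode (m, n)) = m + n"
proof (rule antisym)
  let ?s = "triangle_root (prod_encode (m, n))"
  show "?s \<le> m + n"
  proof (rule ccontr)
    assume "\<not> ?s \<le> m + n"
    then have "triangle (Suc (m + n)) \<le> triangle ?s" by (intro triangle_mono) auto
    with triangle_root[of "prod_encode (m, n)"] show False by (simp add: prod_encode_def)
  qed
  show "m + n \<le> ?s"
  proof (rule ccontr)
    assume "\<not> m + n \<le> ?s"
    then have "triangle (Suc ?s) \<le> triangle (m + n)" by (intro triangle_mono) auto
    with triangle_root[of "prod_encode (m, n)"] show False by (simp add: prod_encode_def)
  qed
qed

lemma fst_prod_decode: "fst (prod_decode n) = n - triangle (triangle_root n)"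
  using triangle_root_prod_encode[of "fst (prod_decode n)" "snd (prod_decode n)"]
  by (simp add: prod_encode_def) (metis (no_types, lifting) add_diff_cancel_left' case_prod_unfold prod_decode_inverse prod_encode_def)

lemma snd_prod_decode: "snd (prod_decode n) = triangle_root n - fst (prod_decode n)"
  using triangle_root_prod_encode[of "fst (prod_decode n)" "snd (prod_decode n)"] by simp

lemma recursive_on_triangle_root:
  assumes "recursive_on k f" shows "recursive_on k (\<lambda>xs. triangle_root (f xs))"
  unfolding triangle_root_def
  by (intro recursive_on_rec_closed[OF _ assms] recursive_on_if0 recursive_on_diff recursive_on_triangle
      recursive_on_Suc recursive_on_nth) auto

lemma recursive_on_fst_decode:
  "recursive_on k f \<Longrightarrow> recursive_on k (\<lambda>xs. fst (prod_decode (f xs)))"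
  unfolding fst_prod_decode by (intro recursive_on_diff recursive_on_triangle recursive_on_triangle_root)

lemma recursive_on_snd_decode:
  "recursive_on k f \<Longrightarrow> recursive_on k (\<lambda>xs. snd (prod_decode (f xs)))"
  unfolding snd_prod_decode by (intro recursive_on_diff recursive_on_fst_decode recursive_on_triangle_root)

section \<open>Computable functions between coded types\<close>

text \<open>Codes chosen by type let one predicate \<open>computable\<close> serve numbers, pairs,
  lists and truth values, so that computability of a term follows from its syntax through
  \<open>comp_intro\<close>.\<close>

class coded =
  fixes code :: "'a \<Rightarrow> nat"

instantiation nat :: coded
begin
definition code_nat :: "nat \<Rightarrow> nat" where "code_nat n = n"
instance ..
end

instantiation bool :: coded
begin
definition code_bool :: "bool \<Rightarrow> nat" where "code_bool b = of_bool b"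
instance ..
end

instantiation prod :: (coded, coded) coded
begin
definition code_prod :: "'a \<times> 'b \<Rightarrow> nat" where "code_prod x = prod_encode (code (fst x), code (snd x))"
instance ..
end

instantiation list :: (coded) coded
begin
definition code_list :: "'a list \<Rightarrow> nat" where "code_list xs = list_encode (map code xs)"
instance ..
end

lemmas code_defs = code_nat_def code_bool_def code_prod_def code_list_def

definition computable :: "('a::coded \<Rightarrow> 'b::coded) \<Rightarrow> bool" where
  "computable f \<longleftrightarrow> (\<exists>g. total_recursive g \<and> (\<forall>x. g (code x) = code (f x)))"

named_theorems comp_intro

lemma computableI: "total_recursive g \<Longrightarrow> (\<And>x. g (code x) = code (f x)) \<Longrightarrow> computable f"
  unfolding computable_def by blast

lemma computableE:
  assumes "computable f"
  obtains g where "total_recursive g" "\<And>x. g (code x) = code (f x)"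
  using assms unfolding computable_def by blast

lemma total_recursive_iff: "total_recursive f \<longleftrightarrow> recursive_on 1 (\<lambda>xs. f (xs ! 0))"
proof -
  have "recursive_on 1 (\<lambda>xs. f (xs ! 0)) \<longleftrightarrow> recursive_on 1 (\<lambda>xs. f (hd xs))"
    unfolding recursive_on_def by (intro ex_cong1 all_cong1) (auto simp: length_Suc_conv)
  then show ?thesis unfolding recursive_on_1 by blast
qed

lemma computable_nat: "computable (f :: nat \<Rightarrow> nat) \<longleftrightarrow> total_recursive f"
proof -
  have "g = f" if "\<forall>x. g x = f x" for g using that by (intro ext) simp
  then show ?thesis by (auto simp: computable_def code_nat_def)
qed

lemma computable_comp: 
  assumes "computable g" "computable f" shows "computable (\<lambda>x. g (f x))"
proof -
  obtain g' where g: "total_recursive g'" "\<And>x. g' (code x) = code (g x)" using assms(1) by (rule computableE) blast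
  obtain f' where f: "total_recursive f'" "\<And>x. f' (code x) = code (f x)" using assms(2) by (rule computableE) blast
  show ?thesis
    by (rule computableI[of "\<lambda>x. g' (f' x)"])
      (use g f in \<open>auto simp: total_recursive_iff intro: recursive_on_total_recursive recursive_on_nth\<close>)
qed

lemma computable_id [comp_intro]: "computable (\<lambda>x. x)"
  by (rule computableI[of "\<lambda>x. x"]) (auto simp: total_recursive_iff recursive_on_nth)

lemma computable_const [comp_intro]: "computable (\<lambda>x. c)"
  by (rule computableI[of "\<lambda>x. code c"]) (auto simp: total_recursive_iff recursive_on_const)

lemma computable_Pair [comp_intro]:
  assumes "computable f" "computable g" shows "computable (\<lambda>x. (f x, g x))"
proof -
  obtain g' where g: "total_recursive g'" "\<And>x. g' (code x) = code (g x)" using assms(2) by (rule computableE) blast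
  obtain f' where f: "total_recursive f'" "\<And>x. f' (code x) = code (f x)" using assms(1) by (rule computableE) blast
  show ?thesis
    by (rule computableI[of "\<lambda>x. prod_encode (f' x, g' x)"])
      (use g f in \<open>auto simp: total_recursive_iff code_prod_def intro!: recursive_on_prod_encode\<close>)
qed

lemma computable_fst [comp_intro]:
  assumes "computable f" shows "computable (\<lambda>x. fst (f x))"
proof -
  have "computable (fst :: 'b \<times> 'c \<Rightarrow> _)"
    by (rule computableI[of "\<lambda>x. fst (prod_decode x)"])
      (auto simp: total_recursive_iff code_prod_def intro!: recursive_on_fst_decode recursive_on_nth)
  then show ?thesis using assms by (rule computable_comp)
qed

lemma computable_snd [comp_intro]:
  assumes "computable f" shows "computable (\<lambda>x. snd (f x))"
proof -
  have "computable (snd :: 'b \<times> 'c \<Rightarrow> _)"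
    by (rule computableI[of "\<lambda>x. snd (prod_decode x)"])
      (auto simp: total_recursive_iff code_prod_def intro!: recursive_on_snd_decode recursive_on_nth)
  then show ?thesis using assms by (rule computable_comp)
qed

lemma computable_prod_encode [comp_intro]:
  assumes "computable f" "computable g" shows "computable (\<lambda>x. prod_encode (f x, g x))"
proof -
  have "computable prod_encode"
    by (rule computableI[of "\<lambda>x. x"]) (auto simp: total_recursive_iff recursive_on_nth code_defs)
  then show ?thesis using computable_Pair[OF assms] by (rule computable_comp)
qed

lemma computable_prod_decode [comp_intro]:
  assumes "computable f" shows "computable (\<lambda>x. prod_decode (f x))"
proof -
  have "computable prod_decode"
    by (rule computableI[of "\<lambda>x. x"]) (auto simp: total_recursive_iff recursive_on_nth code_defs)
  then show ?thesis using assms by (rule computable_comp)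
qed

lemma computable_binary:
  assumes "recursive_on 2 (\<lambda>xs. op (xs ! 0) (xs ! 1))" "\<And>a b. op (code a) (code b) = code (op' a b)"
    "computable f" "computable g"
  shows "computable (\<lambda>x. op' (f x) (g x))"
proof -
  obtain g' where g: "total_recursive g'" "\<And>x. g' (code x) = code (g x)" using assms(4) by (rule computableE) blast
  obtain f' where f: "total_recursive f'" "\<And>x. f' (code x) = code (f x)" using assms(3) by (rule computableE) blast
  show ?thesis
  proof (rule computableI[of "\<lambda>x. op (f' x) (g' x)"])
    show "total_recursive (\<lambda>x. op (f' x) (g' x))"
      using recursive_on_comp2[OF assms(1) f(1)[unfolded total_recursive_iff] g(1)[unfolded total_recursive_iff]]
      by (simp add: total_recursive_iff)
  qed (simp add: f g assms(2))
qed

lemma computable_Suc [comp_intro]: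
  assumes "computable f" shows "computable (\<lambda>x. Suc (f x))"
proof -
  have "computable Suc"
    by (simp add: computable_nat total_recursive_iff recursive_on_Suc recursive_on_nth)
  then show ?thesis using assms by (rule computable_comp)
qed

lemma computable_add [comp_intro]:
  "computable f \<Longrightarrow> computable g \<Longrightarrow> computable (\<lambda>x. f x + g x :: nat)"
  by (rule computable_binary[of "(+)"]) (auto simp: code_defs intro!: recursive_on_add recursive_on_nth)

lemma computable_diff [comp_intro]:
  "computable f \<Longrightarrow> computable g \<Longrightarrow> computable (\<lambda>x. f x - g x :: nat)"
  by (rule computable_binary[of "(-)"]) (auto simp: code_defs intro!: recursive_on_diff recursive_on_nth)

lemma computable_mult [comp_intro]:
  "computable f \<Longrightarrow> computable g \<Longrightarrow> computable (\<lambda>x. f x * g x :: nat)"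
  by (rule computable_binary[of "(*)"]) (auto simp: code_defs intro!: recursive_on_mult recursive_on_nth)

lemma computable_less_eq [comp_intro]:
  "computable f \<Longrightarrow> computable g \<Longrightarrow> computable (\<lambda>x. f x \<le> (g x :: nat))"
  by (rule computable_binary[of "\<lambda>a b. 1 - (a - b)"])
    (auto simp: code_defs intro!: recursive_on_diff recursive_on_const recursive_on_nth)

lemma computable_conj [comp_intro]:
  "computable f \<Longrightarrow> computable g \<Longrightarrow> computable (\<lambda>x. f x \<and> g x)"
  by (rule computable_binary[of "(*)"]) (auto simp: code_defs intro!: recursive_on_mult recursive_on_nth)

lemma computable_if [comp_intro]:
  assumes "computable b" "computable f" "computable g" shows "computable (\<lambda>x. if b x then f x else g x)"
proof -
  obtain g' where g: "total_recursive g'" "\<And>x. g' (code x) = code (g x)" using assms(3) by (rule computableE) blast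
  obtain f' where f: "total_recursive f'" "\<And>x. f' (code x) = code (f x)" using assms(2) by (rule computableE) blast
  obtain b' where b: "total_recursive b'" "\<And>x. b' (code x) = code (b x)" using assms(1) by (rule computableE) blast
  show ?thesis
    by (rule computableI[of "\<lambda>x. if b' x = 0 then g' x else f' x"])
      (use g f b in \<open>auto simp: total_recursive_iff code_bool_def intro!: recursive_on_if0\<close>)
qed

lemma computable_not [comp_intro]:
  assumes "computable f" shows "computable (\<lambda>x. \<not> f x)"
proof -
  have "(\<lambda>x. \<not> f x) = (\<lambda>x. if f x then False else True)" by auto
  then show ?thesis by (simp only:) (intro comp_intro assms)
qed

lemma computable_disj [comp_intro]:
  assumes "computable f" "computable g" shows "computable (\<lambda>x. f x \<or> g x)"
proof -
  have "(\<lambda>x. f x \<or> g x) = (\<lambda>x. if f x then True else g x)" by auto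
  then show ?thesis by (simp only:) (intro comp_intro assms)
qed

lemma computable_less [comp_intro]:
  "computable f \<Longrightarrow> computable g \<Longrightarrow> computable (\<lambda>x. f x < (g x :: nat))"
  unfolding less_eq_Suc_le by (intro comp_intro)

lemma computable_eq [comp_intro]:
  "computable f \<Longrightarrow> computable g \<Longrightarrow> computable (\<lambda>x. f x = (g x :: nat))"
  unfolding order_eq_iff by (intro comp_intro)

text \<open>The context \<open>x\<close> stays packed in one code \<open>e\<close>, so recursion on
  numbers with a single parameter is enough.\<close>

lemma computable_rec [comp_intro]:
  assumes f: "computable f" and h: "computable h"
    and g: "computable (\<lambda>t. g (fst t) (fst (snd t)) (snd (snd t)))"
  shows "computable (\<lambda>x. rec_nat (f x) (\<lambda>n y. g x n y) (h x))"
proof -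
  obtain f' where f: "total_recursive f'" "\<And>x. f' (code x) = code (f x)" using f by (rule computableE) blast
  obtain h' where h: "total_recursive h'" "\<And>x. h' (code x) = code (h x)" using h by (rule computableE) blast
  obtain g' where g: "total_recursive g'"
    and g'': "\<And>x n y. g' (code (x, n, y)) = code (g x n y)" using g by (rule computableE) force
  let ?F = "\<lambda>e. rec_nat (f' e) (\<lambda>n y. g' (prod_encode (e, prod_encode (n, y)))) (h' e)"
  have "recursive_on 1 (\<lambda>xs. ?F (xs ! 0))"
    by (rule recursive_on_rec_param)
      (use f(1) h(1) in \<open>auto simp: total_recursive_iff intro!: recursive_on_nth recursive_on_prod_encode recursive_on_total_recursive[OF g]\<close>)
  then have "total_recursive ?F" by (simp add: total_recursive_iff)
  moreover have "?F (code x) = code (rec_nat (f x) (\<lambda>n y. g x n y) (h x))" for x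
  proof -
    have "rec_nat (f' (code x)) (\<lambda>n y. g' (prod_encode (code x, prod_encode (n, y)))) m
      = code (rec_nat (f x) (\<lambda>n y. g x n y) m)" for m
      using g''[of x] by (induction m) (auto simp: f code_prod_def code_nat_def)
    then show ?thesis by (simp add: h code_nat_def)
  qed
  ultimately show ?thesis by (rule computableI)
qed

lemma computable_power [comp_intro]:
  assumes "computable f" "computable g" shows "computable (\<lambda>x. f x ^ g x :: nat)"
proof -
  have eq: "m ^ n = rec_nat 1 (\<lambda>_ y. m * y) n" for m n :: nat by (induction n) auto
  show ?thesis unfolding eq by (intro comp_intro assms computable_comp[OF assms(1)])
qed

text \<open>The least \<open>i < n\<close> with \<open>P i\<close>, and \<open>n\<close> if there is none.\<close>

definition search :: "nat \<Rightarrow> (nat \<Rightarrow> bool) \<Rightarrow> nat" where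
  "search n P = rec_nat 0 (\<lambda>i y. if y < i then y else if P i then i else Suc i) n"

lemma search_least: "i < search n P \<Longrightarrow> \<not> P i"
  and search_found: "search n P < n \<Longrightarrow> P (search n P)"
proof -
  have "search n P \<le> n \<and> (\<forall>i<search n P. \<not> P i) \<and> (search n P < n \<longrightarrow> P (search n P))"
    by (induction n) (auto simp: search_def less_Suc_eq)
  then show "i < search n P \<Longrightarrow> \<not> P i" "search n P < n \<Longrightarrow> P (search n P)" by auto
qed

lemma search_eqI:
  assumes "P m" "m < n" "\<And>i. i < m \<Longrightarrow> \<not> P i" shows "search n P = m"
proof (rule antisym)
  show "search n P \<le> m" using search_least[of m n P] assms by (metis not_less)
  then show "m \<le> search n P" using search_found[of n P] assms by (metis le_less_trans not_less)
qed

lemma search_less: assumes "P m" "m < n" shows "search n P < n" "search n P \<le> m"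
proof -
  show "search n P \<le> m" using assms search_least[of m n P] by (metis not_less)
  then show "search n P < n" using assms by simp
qed

lemma computable_search [comp_intro]:
  assumes "computable f" "computable (\<lambda>t. P (fst t) (snd t))"
  shows "computable (\<lambda>x. search (f x) (P x))"
  unfolding search_def
  by (intro comp_intro assms computable_comp[OF assms(2), of "\<lambda>t. (fst t, fst (snd t))", simplified])

lemma computable_ex_less [comp_intro]:
  fixes f :: "'a::coded \<Rightarrow> nat"
  assumes "computable f" "computable (\<lambda>t. P (fst t) (snd t))"
  shows "computable (\<lambda>x. \<exists>i<f x. P x i)"
proof -
  have "(\<lambda>x. \<exists>i<f x. P x i) = (\<lambda>x. search (f x) (P x) < f x)"
    using search_less search_found by (intro ext) metis
  then show ?thesis by (simp only:) (intro comp_intro assms)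
qed

lemma computable_sum [comp_intro]:
  fixes f :: "'a::coded \<Rightarrow> nat"
  assumes "computable f" "computable (\<lambda>t. g (fst t) (snd t))"
  shows "computable (\<lambda>x. \<Sum>i<f x. g x i :: nat)"
proof -
  have eq: "(\<Sum>i<n. g x i) = rec_nat 0 (\<lambda>i y. y + g x i) n" for x n by (induction n) auto
  show ?thesis unfolding eq
    by (intro comp_intro assms computable_comp[OF assms(2), of "\<lambda>t. (fst t, fst (snd t))", simplified])
qed

lemma computable_div2 [comp_intro]:
  assumes "computable f" shows "computable (\<lambda>x. f x div 2 :: nat)"
proof -
  have "n div 2 = search (Suc n) (\<lambda>h. n < 2 * h + 2)" for n :: nat
    by (rule search_eqI[symmetric]) auto
  then show ?thesis by (simp only:) (intro comp_intro assms computable_comp[OF assms])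
qed

lemma computable_even [comp_intro]:
  assumes "computable f" shows "computable (\<lambda>x. even (f x :: nat))"
proof -
  have "even n \<longleftrightarrow> n = 2 * (n div 2)" for n :: nat by presburger
  then show ?thesis by (simp only:) (intro comp_intro assms)
qed

section \<open>Lists and finite prefixes\<close>

lemma computable_Cons [comp_intro]:
  "computable f \<Longrightarrow> computable g \<Longrightarrow> computable (\<lambda>x. f x # g x)"
  by (rule computable_binary[of "\<lambda>a b. Suc (prod_encode (a, b))"])
    (auto simp: code_list_def intro!: recursive_on_Suc recursive_on_prod_encode recursive_on_nth)

lemma computable_code [comp_intro]: "computable f \<Longrightarrow> computable (\<lambda>x. code (f x))"
proof -
  have "computable (code :: 'b \<Rightarrow> nat)"
    by (rule computableI[of "\<lambda>x. x"]) (auto simp: total_recursive_iff recursive_on_nth code_nat_def)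
  then show "computable f \<Longrightarrow> computable (\<lambda>x. code (f x))" by (rule computable_comp)
qed

lemma computable_tl [comp_intro]:
  assumes "computable f" shows "computable (\<lambda>x. tl (f x))"
proof -
  have "computable (tl :: 'b list \<Rightarrow> 'b list)"
  proof (rule computableI[of "\<lambda>n. snd (prod_decode (n - 1))"])
    \<comment> \<open>The empty list has code 0, and \<open>0 - 1 = 0\<close> decodes to
      \<open>(0, 0)\<close>, so \<open>tl [] = []\<close> needs no case distinction.\<close>
    have "prod_encode (0, 0) = 0" by (simp add: prod_encode_def)
    then have "prod_decode 0 = (0, 0)" by (metis prod_encode_inverse)
    then show "snd (prod_decode (code xs - 1)) = code (tl xs)" for xs :: "'b list"
      by (cases xs) (auto simp: code_list_def)
  qed (auto simp: total_recursive_iff intro!: recursive_on_snd_decode recursive_on_diff recursive_on_const recursive_on_nth)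
  then show ?thesis using assms by (rule computable_comp)
qed

lemma computable_drop [comp_intro]:
  assumes "computable f" "computable g" shows "computable (\<lambda>x. drop (g x) (f x))"
proof -
  have "drop n xs = rec_nat xs (\<lambda>_. tl) n" for n and xs :: "'b list"
    by (induction n) (auto simp: drop_Suc simp flip: tl_drop)
  then show ?thesis by (simp only:) (intro comp_intro assms)
qed

text \<open>Bounds the search in \<open>computable_length\<close>.\<close>

lemma length_le_code: "length xs \<le> code xs"
proof (induction xs)
  case (Cons x xs)
  then show ?case
    using le_prod_encode_2[of "code xs" "code x"] by (simp add: code_list_def)
qed simp

lemma code_list_eq_0_iff: "code xs = 0 \<longleftrightarrow> xs = ([] :: 'a::coded list)"
  by (cases xs) (auto simp: code_list_def)

lemma computable_length [comp_intro]:
  assumes "computable f" shows "computable (\<lambda>x. length (f x))"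
proof -
  have "length xs = search (Suc (code xs)) (\<lambda>k. code (drop k xs) = 0)" for xs :: "'b list"
    using length_le_code[of xs] by (intro search_eqI[symmetric]) (auto simp: code_list_eq_0_iff)
  then show ?thesis by (simp only:) (intro comp_intro assms computable_comp[OF assms])
qed

text \<open>Oracle access to a finite prefix: \<open>0\<close> signals that the prefix is too short.\<close>

definition look :: "nat list \<Rightarrow> nat \<Rightarrow> nat" where
  "look xs i = (if i < length xs then Suc (xs ! i) else 0)"

lemma computable_look [comp_intro]:
  assumes "computable f" "computable g" shows "computable (\<lambda>x. look (f x) (g x))"
proof -
  have hd: "computable (\<lambda>xs. look xs 0)"
  proof (rule computableI[of "\<lambda>n. if n = 0 then 0 else Suc (fst (prod_decode (n - 1)))"])
    show "(if code xs = 0 then 0 else Suc (fst (prod_decode (code xs - 1)))) = code (look xs 0)" for xs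
      by (cases xs) (auto simp: code_list_def code_nat_def look_def)
  qed (auto simp: total_recursive_iff intro!: recursive_on_if0 recursive_on_Suc recursive_on_fst_decode
      recursive_on_diff recursive_on_const recursive_on_nth)
  have "(\<lambda>x. look (f x) (g x)) = (\<lambda>x. look (drop (g x) (f x)) 0)" by (auto simp: look_def)
  then show ?thesis by (simp only:) (intro computable_comp[OF hd] comp_intro assms)
qed

lemma computable_map_upt [comp_intro]:
  fixes g :: "'a::coded \<Rightarrow> nat \<Rightarrow> 'b::coded"
  assumes f: "computable f" and g: "computable (\<lambda>t. g (fst t) (snd t))"
  shows "computable (\<lambda>x. map (g x) [0..<f x])"
proof -
  \<comment> \<open>Recursion only adds elements in front, so the list is built from its last entry
    backwards.\<close>
  have "rec_nat [] (\<lambda>i ys. g x (n - Suc i) # ys) k = map (g x) [n - k..<n]" if "k \<le> n" for x k n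
    using that
  proof (induction k)
    case (Suc k)
    then have "[n - Suc k..<n] = (n - Suc k) # [n - k..<n]"
      by (subst upt_conv_Cons) (auto simp: Suc_diff_Suc)
    then show ?case using Suc by simp
  qed simp
  from this[of n n for n] have eq: "map (g x) [0..<n] = rec_nat [] (\<lambda>i ys. g x (n - Suc i) # ys) n" for x n
    by simp
  show ?thesis unfolding eq
    by (intro comp_intro computable_comp[OF f] f
        computable_comp[OF g, of "\<lambda>t. (fst t, f (fst t) - Suc (fst (snd t)))", simplified])
qed

lemma computable_take [comp_intro]:
  fixes f :: "'a::coded \<Rightarrow> nat list"
  assumes "computable f" "computable g" shows "computable (\<lambda>x. take (g x) (f x))"
proof -
  have "take n xs = map (\<lambda>i. look xs i - 1) [0..<if n \<le> length xs then n else length xs]" for n and xs :: "nat list"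
    by (intro nth_equalityI) (auto simp: look_def)
  then show ?thesis by (simp only:) (intro comp_intro assms computable_comp[OF assms(1)])
qed

section \<open>Computable functionals on Baire space\<close>

lemma length_pref [simp]: "length (pref p k) = k"
  by (simp add: pref_def)

lemma nth_pref [simp]: "i < k \<Longrightarrow> pref p k ! i = p i"
  by (simp add: pref_def)

lemma take_pref: "take m (pref p k) = pref p (min m k)"
  by (intro nth_equalityI) auto

lemma look_pref: "look (pref p k) i = (if i < k then Suc (p i) else 0)"
  by (simp add: look_def)

lemma assoc_val_code: "assoc_val a p n k = a (code (n, pref p k))"
proof -
  have "map code xs = xs" for xs :: "nat list" by (simp add: code_nat_def map_idI)
  then show ?thesis by (simp add: assoc_val_def code_prod_def code_list_def code_nat_def)
qed

text \<open>If every positive answer is right, so is the first one, and the minimal prefix need not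
  be identified.\<close>

lemma computable_pfI:
  fixes \<phi> :: "nat \<times> nat list \<Rightarrow> nat"
  assumes \<phi>: "computable \<phi>"
    and val: "\<And>p q n. F p = Some q \<Longrightarrow> \<exists>k. 0 < \<phi> (n, pref p k)"
      "\<And>p q n k. F p = Some q \<Longrightarrow> 0 < \<phi> (n, pref p k) \<Longrightarrow> \<phi> (n, pref p k) = Suc (q n)"
  shows "computable_pf F"
proof -
  obtain a where a: "total_recursive a" "\<And>x. a (code x) = code (\<phi> x)" using \<phi> by (rule computableE) blast
  have eq: "assoc_val a p n k = \<phi> (n, pref p k)" for p n k
    by (simp add: assoc_val_code a code_nat_def)
  have "q n = \<phi> (n, pref p (LEAST k. 0 < \<phi> (n, pref p k))) - 1" if "F p = Some q" for p q n
    using val(2)[OF that LeastI_ex[OF val(1)[OF that]], of n] by simp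
  then show ?thesis unfolding computable_pf_def eq using a(1) val(1) by (auto simp: eq)
qed

text \<open>The functional defined by an associate, whose values at different prefixes need not agree.\<close>

definition run :: "(nat \<times> nat list \<Rightarrow> nat) \<Rightarrow> baire \<Rightarrow> baire option" where
  "run \<phi> p = (if \<forall>n. \<exists>k. 0 < \<phi> (n, pref p k)
     then Some (\<lambda>n. \<phi> (n, pref p (LEAST k. 0 < \<phi> (n, pref p k))) - 1) else None)"

lemma computable_pf_run:
  assumes "computable \<phi>" shows "computable_pf (run \<phi>)"
proof -
  obtain a where a: "total_recursive a" "\<And>x. a (code x) = code (\<phi> x)" using assms by (rule computableE) blast
  have eq: "assoc_val a p n k = \<phi> (n, pref p k)" for p n k
    by (simp add: assoc_val_code a code_nat_def)
  show ?thesis unfolding computable_pf_def eq using a(1)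
    by (intro exI[of _ a]) (auto simp: eq run_def split: if_splits)
qed

text \<open>Associates answer entry by entry and are awkward to compose. Maps from input prefixes to
  output prefixes compose as ordinary functions.\<close>

definition tracks :: "(nat list \<Rightarrow> nat list) \<Rightarrow> (baire \<Rightarrow> baire option) \<Rightarrow> bool" where
  "tracks h F \<longleftrightarrow> computable h \<and> (\<forall>p q. F p = Some q \<longrightarrow>
     (\<forall>k. \<exists>l. h (pref p k) = pref q l) \<and> (\<forall>m. \<exists>k0. \<forall>k\<ge>k0. m \<le> length (h (pref p k))))"

lemma tracksD:
  assumes "tracks h F"
  shows "computable h" "F p = Some q \<Longrightarrow> h (pref p k) = pref q (length (h (pref p k)))"
    "F p = Some q \<Longrightarrow> \<exists>k0. \<forall>k\<ge>k0. m \<le> length (h (pref p k))"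
proof -
  show "computable h" using assms by (simp add: tracks_def)
  assume F: "F p = Some q"
  then obtain l where "h (pref p k) = pref q l" using assms unfolding tracks_def by metis
  then show "h (pref p k) = pref q (length (h (pref p k)))" by simp
  show "\<exists>k0. \<forall>k\<ge>k0. m \<le> length (h (pref p k))" using assms F unfolding tracks_def by metis
qed

lemma computable_pf_tracks: "computable_pf F \<longleftrightarrow> (\<exists>h. tracks h F)"
proof
  assume "\<exists>h. tracks h F"
  then obtain h where h: "tracks h F" ..
  note [comp_intro] = computable_comp[OF tracksD(1)[OF h]]
  show "computable_pf F"
  proof (rule computable_pfI)
    show "computable (\<lambda>x. look (h (snd x)) (fst x))" by (intro comp_intro)
    fix p q n assume F: "F p = Some q"
    from tracksD(3)[OF h F, of "Suc n"] obtain k where "n < length (h (pref p k))" by (auto simp: Suc_le_eq)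
    then show "\<exists>k. 0 < look (h (snd (n, pref p k))) (fst (n, pref p k))" by (auto simp: look_def)
    show "look (h (snd (n, pref p k))) (fst (n, pref p k)) = Suc (q n)"
      if "0 < look (h (snd (n, pref p k))) (fst (n, pref p k))" for k
      using that tracksD(2)[OF h F, of k] by (auto simp: look_def split: if_splits) (metis nth_pref)
  qed
next
  assume "computable_pf F"
  then obtain a where a: "total_recursive a"
    and F: "\<And>p q n. F p = Some q \<Longrightarrow> (\<exists>k. 0 < assoc_val a p n k) \<and>
             q n = assoc_val a p n (LEAST k. 0 < assoc_val a p n k) - 1"
    unfolding computable_pf_def by blast
  define \<alpha> where "\<alpha> n \<sigma> = a (code (n, \<sigma>))" for n :: nat and \<sigma> :: "nat list"
  \<comment> \<open>\<open>s\<close> gives the shortest prefix with an answer for entry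
    \<open>m\<close>, or \<open>Suc (length \<sigma>)\<close> if there is none; \<open>h\<close>
    outputs the entries before the first unanswered one.\<close>
  define s where "s \<sigma> m = search (Suc (length \<sigma>)) (\<lambda>k. 0 < \<alpha> m (take k \<sigma>))" for \<sigma> m
  define h where "h \<sigma> = map (\<lambda>m. \<alpha> m (take (s \<sigma> m) \<sigma>) - 1)
    [0..<search (length \<sigma>) (\<lambda>m. \<not> s \<sigma> m < Suc (length \<sigma>))]" for \<sigma>
  have a': "computable a" by (simp add: computable_nat a)
  note [comp_intro] = computable_comp[OF a']
  have "computable h"
    unfolding h_def s_def \<alpha>_def by (intro comp_intro)
  moreover have "\<exists>l. h (pref p k) = pref q l" if Fp: "F p = Some q" for p q k
  proof -
    let ?M = "search k (\<lambda>m. \<not> s (pref p k) m < Suc k)"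
    have "\<alpha> m (take (s (pref p k) m) (pref p k)) - 1 = q m" if m: "m < ?M" for m
    proof -
      let ?s = "s (pref p k) m"
      have lt: "?s < Suc k" using search_least[OF m] by blast
      have pos: "0 < assoc_val a p m ?s"
        using search_found[of "Suc k" "\<lambda>j. 0 < \<alpha> m (take j (pref p k))"] lt
        by (simp add: s_def \<alpha>_def assoc_val_code take_pref min.absorb1)
      have "\<not> 0 < assoc_val a p m i" if "i < ?s" for i
        using search_least[of i "Suc k" "\<lambda>j. 0 < \<alpha> m (take j (pref p k))"] that lt
        by (simp add: s_def \<alpha>_def assoc_val_code take_pref min.absorb1)
      then have "(LEAST k. 0 < assoc_val a p m k) = ?s"
        using pos by (intro Least_equality) (auto simp: not_less[symmetric])
      then show ?thesis using F[OF Fp, of m] lt by (simp add: \<alpha>_def assoc_val_code take_pref min.absorb1)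
    qed
    then have "h (pref p k) = pref q ?M"
      by (intro nth_equalityI) (auto simp: h_def)
    then show ?thesis ..
  qed
  moreover have "\<exists>k0. \<forall>k\<ge>k0. m \<le> length (h (pref p k))" if Fp: "F p = Some q" for p q m
  proof -
    from F[OF Fp] obtain f where f: "\<And>n. 0 < assoc_val a p n (f n)" by metis
    \<comment> \<open>The sum dominates each \<open>f i\<close> with \<open>i < m\<close>, so all
      these entries are answered; the summand \<open>m\<close> is there because \<open>h\<close>
      emits at most \<open>k\<close> entries.\<close>
    have "m \<le> length (h (pref p k))" if k: "m + sum f {..<m} \<le> k" for k
    proof (rule ccontr)
      assume "\<not> m \<le> length (h (pref p k))"
      then have "search k (\<lambda>m. \<not> s (pref p k) m < Suc k) < m" by (simp add: h_def)
      then obtain i where i: "i = search k (\<lambda>m. \<not> s (pref p k) m < Suc k)" and lt: "i < m" by blast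
      have "f i \<le> sum f {..<m}" using lt by (intro member_le_sum) auto
      then have fk: "f i \<le> k" using k by simp
      have "s (pref p k) i < Suc k"
        unfolding s_def length_pref using f[of i] fk
        by (intro search_less(1)[of _ "f i"]) (auto simp: \<alpha>_def assoc_val_code take_pref min.absorb1)
      moreover have "\<not> s (pref p k) i < Suc k"
        using search_found[of k "\<lambda>m. \<not> s (pref p k) m < Suc k"] lt k i by simp
      ultimately show False by blast
    qed
    then show ?thesis by blast
  qed
  ultimately have "tracks h F" unfolding tracks_def by blast
  then show "\<exists>h. tracks h F" by blast
qed

lemma computable_pf_bind:
  assumes "computable_pf F" "computable_pf G"
  shows "computable_pf (\<lambda>p. Option.bind (F p) G)"
proof -
  obtain f g where f: "tracks f F" and g: "tracks g G" using assms unfolding computable_pf_tracks by blast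
  have "tracks (\<lambda>\<sigma>. g (f \<sigma>)) (\<lambda>p. Option.bind (F p) G)"
    unfolding tracks_def
  proof (intro conjI allI impI computable_comp[OF tracksD(1)[OF g] tracksD(1)[OF f]])
    fix p r assume "Option.bind (F p) G = Some r"
    then obtain q where Fp: "F p = Some q" and Gq: "G q = Some r" by (auto simp: bind_eq_Some_conv)
    show "\<exists>l. g (f (pref p k)) = pref r l" for k
      using tracksD(2)[OF f Fp, of k] tracksD(2)[OF g Gq] by metis
    show "\<exists>k0. \<forall>k\<ge>k0. m \<le> length (g (f (pref p k)))" for m
      using tracksD(2)[OF f Fp] tracksD(3)[OF g Gq, of m] tracksD(3)[OF f Fp] by metis
  qed
  then show ?thesis unfolding computable_pf_tracks by blast
qed

definition weave :: "nat list \<Rightarrow> nat list \<Rightarrow> nat list" where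
  "weave \<sigma> \<tau> = map (\<lambda>i. look (if even i then \<sigma> else \<tau>) (i div 2) - 1)
     [0..<2 * (if length \<sigma> \<le> length \<tau> then length \<sigma> else length \<tau>)]"

lemma computable_weave [comp_intro]:
  assumes "computable f" "computable g" shows "computable (\<lambda>x. weave (f x) (g x))"
  unfolding weave_def by (intro comp_intro assms computable_comp[OF assms(1)] computable_comp[OF assms(2)])

lemma length_weave: "length (weave \<sigma> \<tau>) = 2 * min (length \<sigma>) (length \<tau>)"
  by (simp add: weave_def)

lemma weave_pref: "weave (pref p k) (pref q l) = pref (pair_b p q) (2 * min k l)"
  by (intro nth_equalityI) (auto simp: weave_def look_pref pair_b_def min_def split: if_splits)

lemma computable_pf_pair:
  assumes "computable_pf F" "computable_pf G"
  shows "computable_pf (\<lambda>p. Option.bind (F p) (\<lambda>x. Option.bind (G p) (\<lambda>y. Some (pair_b x y))))"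
proof -
  obtain f g where f: "tracks f F" and g: "tracks g G" using assms unfolding computable_pf_tracks by blast
  have "tracks (\<lambda>\<sigma>. weave (f \<sigma>) (g \<sigma>)) (\<lambda>p. Option.bind (F p) (\<lambda>x. Option.bind (G p) (\<lambda>y. Some (pair_b x y))))"
    unfolding tracks_def
  proof (intro conjI allI impI)
    show "computable (\<lambda>\<sigma>. weave (f \<sigma>) (g \<sigma>))"
      by (intro comp_intro tracksD(1)[OF f] tracksD(1)[OF g])
    fix p r assume "Option.bind (F p) (\<lambda>x. Option.bind (G p) (\<lambda>y. Some (pair_b x y))) = Some r"
    then obtain q q' where Fp: "F p = Some q" and Gp: "G p = Some q'" and r: "r = pair_b q q'"
      by (auto simp: bind_eq_Some_conv)
    show "\<exists>l. weave (f (pref p k)) (g (pref p k)) = pref r l" for k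
      using tracksD(2)[OF f Fp, of k] tracksD(2)[OF g Gp, of k] weave_pref r by metis
    show "\<exists>k0. \<forall>k\<ge>k0. m \<le> length (weave (f (pref p k)) (g (pref p k)))" for m
    proof -
      obtain k1 k2 where "\<forall>k\<ge>k1. m \<le> length (f (pref p k))" "\<forall>k\<ge>k2. m \<le> length (g (pref p k))"
        using tracksD(3)[OF f Fp] tracksD(3)[OF g Gp] by metis
      then have "\<forall>k\<ge>max k1 k2. m \<le> length (weave (f (pref p k)) (g (pref p k)))"
        by (auto simp: length_weave trans_le_add1 mult_2)
      then show ?thesis ..
    qed
  qed
  then show ?thesis unfolding computable_pf_tracks by blast
qed

lemma computable_pf_id: "computable_pf Some"
  by (rule computable_pfI[of "\<lambda>x. look (snd x) (fst x)"])
    (auto simp: look_pref split: if_splits intro!: comp_intro)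

lemma pair_b_simps [simp]: "pair_b p q (2 * n) = p n" "pair_b p q (Suc (2 * n)) = q n"
  by (auto simp: pair_b_def)

lemma computable_pf_fst: "computable_pf (\<lambda>p. Some (\<lambda>n. p (2 * n)))"
  by (rule computable_pfI[of "\<lambda>x. look (snd x) (2 * fst x)"])
    (auto simp: look_pref split: if_splits intro!: comp_intro)

lemma computable_pf_snd: "computable_pf (\<lambda>p. Some (\<lambda>n. p (Suc (2 * n))))"
  by (rule computable_pfI[of "\<lambda>x. look (snd x) (Suc (2 * fst x))"])
    (auto simp: look_pref split: if_splits intro!: comp_intro)

text \<open>Meant for enumerations: an entry that looks only at the first \<open>n\<close> inputs
  always has a value, at the cost of overlooking evidence further out.\<close>

lemma computable_pf_test:
  assumes "computable (\<lambda>x. test (fst x) (snd x))"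
  shows "computable_pf (\<lambda>p. Some (\<lambda>n. test (pref p n) n))"
  by (rule computable_pfI[of "\<lambda>x. if fst x \<le> length (snd x) then Suc (test (take (fst x) (snd x)) (fst x)) else 0"])
    (auto simp: take_pref min.absorb1 split: if_splits intro!: comp_intro
      computable_comp[OF assms, of "\<lambda>x. (take (fst x) (snd x), fst x)", simplified])

section \<open>Codes of binary words\<close>

text \<open>\<open>Suc (bl_code w)\<close> is the binary numeral with a leading 1 followed by
  \<open>w\<close> in reverse, the first letter being least significant. Hence the powers of two
  here and below.\<close>

lemma bl_code_append: "bl_code (w @ v) = bl_code w + 2 ^ length w * bl_code v"
  by (induction w) (auto simp: algebra_simps)

lemma bl_code_replicate: "Suc (bl_code (replicate k False)) = 2 ^ k"
  by (induction k) auto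

lemma bl_code_eq_0_iff [simp]: "bl_code w = 0 \<longleftrightarrow> w = []"
  by (cases w) auto

lemma inj_bl_code: "inj bl_code"
proof (rule injI)
  show "bl_code w = bl_code v \<Longrightarrow> w = v" for w v
  proof (induction w arbitrary: v)
    case Nil
    then show ?case by (metis bl_code_eq_0_iff)
  next
    case (Cons b w)
    then obtain c u where v: "v = c # u" by (cases v) auto
    have eq: "2 * bl_code w + of_bool b = 2 * bl_code u + of_bool c"
      using Cons.prems v by (simp add: of_bool_def)
    from arg_cong[OF eq, of even] have "b = c" by (cases b; cases c) simp_all
    with eq Cons.IH[of u] v show ?case by simp
  qed
qed

lemma bl_code_eq_iff [simp]: "bl_code w = bl_code v \<longleftrightarrow> w = v"
  using inj_bl_code by (rule inj_eq)

lemma bl_code_surj: "\<exists>w. bl_code w = n"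
proof (induction n rule: less_induct)
  case (less n)
  show ?case
  proof (cases n)
    case (Suc m)
    have "m div 2 < n" using Suc by (simp add: less_Suc_eq_le)
    from less.IH[OF this] obtain w where "bl_code w = m div 2" ..
    then have "bl_code (odd m # w) = n"
      using Suc by (auto simp: odd_two_times_div_two_succ)
    then show ?thesis ..
  qed (metis bl_code.simps(1))
qed

lemma bl_code_bounds: "2 ^ length w \<le> Suc (bl_code w) \<and> Suc (bl_code w) < 2 * 2 ^ length w"
  by (induction w) auto

lemma finite_words [simp]: "finite {w :: bool list. length w = l}"
  using finite_lists_length_eq[of "UNIV :: bool set" l] by simp

lemma card_words: "card {w :: bool list. length w = l} = 2 ^ l"
  using card_lists_length_eq[of "UNIV :: bool set" l] by simp

text \<open>The size bounds give one inclusion; injectivity and equal cardinality give the other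
  without an explicit inverse.\<close>

lemma bl_code_words: "bl_code ` {w. length w = l} = {2 ^ l - 1..<2 ^ l - 1 + 2 ^ l}"
proof (rule card_subset_eq)
  show "bl_code ` {w. length w = l} \<subseteq> {2 ^ l - 1..<2 ^ l - 1 + 2 ^ l}"
  proof
    fix x assume "x \<in> bl_code ` {w. length w = l}"
    then obtain w where "x = bl_code w" "length w = l" by auto
    with bl_code_bounds[of w] show "x \<in> {2 ^ l - 1..<2 ^ l - 1 + 2 ^ l}" by auto
  qed
  show "card (bl_code ` {w. length w = l}) = card {2 ^ l - 1..<2 ^ l - 1 + 2 ^ l :: nat}"
    using inj_on_subset[OF inj_bl_code] by (subst card_image) (auto simp: card_words)
qed simp

text \<open>Turns a sum over words into a bounded sum over numbers, which
  \<open>computable_sum\<close> covers.\<close>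

lemma sum_words: "(\<Sum>c<2 ^ l. g (2 ^ l - 1 + c)) = (\<Sum>w | length w = l. g (bl_code w))"
proof -
  have "(\<Sum>w | length w = l. g (bl_code w)) = sum g (bl_code ` {w. length w = l})"
    using inj_on_subset[OF inj_bl_code] by (subst sum.reindex) auto
  also have "\<dots> = (\<Sum>c<2 ^ l. g (2 ^ l - 1 + c))"
    unfolding bl_code_words using sum.shift_bounds_nat_ivl[of g 0 "2 ^ l - 1" "2 ^ l"]
    by (simp add: atLeast0LessThan add.commute)
  finally show ?thesis by simp
qed

text \<open>Each step removes the first letter of the coded word; truncated subtraction keeps the
  code 0 of the empty word fixed.\<close>

definition shift_code :: "nat \<Rightarrow> nat \<Rightarrow> nat" where
  "shift_code a k = rec_nat a (\<lambda>_ y. (y - 1) div 2) k"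

lemma shift_code: "shift_code (bl_code w) k = bl_code (drop k w)"
proof (induction k)
  case (Suc k)
  have "(bl_code v - 1) div 2 = bl_code (tl v)" for v by (cases v) auto
  then show ?case using Suc by (simp add: shift_code_def drop_Suc tl_drop)
qed (simp add: shift_code_def)

definition code_length :: "nat \<Rightarrow> nat" where
  "code_length a = search (Suc a) (\<lambda>k. shift_code a k = 0)"

lemma code_length: "code_length (bl_code w) = length w"
proof -
  have "length w < 2 ^ length w" by (rule less_exp)
  then have "length w < Suc (bl_code w)" using bl_code_bounds[of w] by linarith
  then show ?thesis unfolding code_length_def by (intro search_eqI) (auto simp: shift_code)
qed

text \<open>The successor in \<open>bl_code\<close> flips parity: a nonempty word has an even code
  exactly if it starts with \<open>True\<close>.\<close>

lemma code_bit: "k < length w \<Longrightarrow> even (shift_code (bl_code w) k) \<longleftrightarrow> w ! k"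
  by (simp add: shift_code Cons_nth_drop_Suc[symmetric])

lemma computable_shift_code [comp_intro]:
  "computable f \<Longrightarrow> computable g \<Longrightarrow> computable (\<lambda>x. shift_code (f x) (g x))"
  unfolding shift_code_def by (intro comp_intro)

lemma computable_code_length [comp_intro]:
  assumes "computable f" shows "computable (\<lambda>x. code_length (f x))"
  unfolding code_length_def by (intro comp_intro assms computable_comp[OF assms])

section \<open>Trees and the uniform measure\<close>

definition level :: "bool list set \<Rightarrow> nat \<Rightarrow> bool list set" where
  "level T l = {w \<in> T. length w = l}"

definition subtree :: "bool list \<Rightarrow> bool list set \<Rightarrow> bool list set" where
  "subtree w T = {v. w @ v \<in> T}"

definition graft :: "bool list \<Rightarrow> bool list set \<Rightarrow> bool list set" where
  "graft w T = {u. (\<exists>k<length w. u = take k w) \<or> (\<exists>v\<in>T. u = w @ v)}"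

definition append_seq :: "bool list \<Rightarrow> (nat \<Rightarrow> bool) \<Rightarrow> nat \<Rightarrow> bool" where
  "append_seq w y = (\<lambda>n. if n < length w then w ! n else y (n - length w))"

lemma finite_level [simp]: "finite (level T l)"
  by (rule finite_subset[OF _ finite_words[of l]]) (auto simp: level_def)

lemma is_treeD: "is_tree T \<Longrightarrow> w @ v \<in> T \<Longrightarrow> w \<in> T"
  unfolding is_tree_def by (metis append_eq_conv_conj)

lemma is_tree_subtree:
  assumes "is_tree T" shows "is_tree (subtree w T)"
  unfolding is_tree_def subtree_def
proof (intro allI impI CollectI)
  fix v n assume "v \<in> {v. w @ v \<in> T}"
  then have "take (length w + n) (w @ v) \<in> T" using assms unfolding is_tree_def by blast
  then show "w @ take n v \<in> T" by simp
qed

lemma is_tree_graft: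
  assumes "is_tree T" shows "is_tree (graft w T)"
  unfolding is_tree_def
proof (intro allI impI)
  fix u n assume "u \<in> graft w T"
  then consider k where "k < length w" "u = take k w" | v where "v \<in> T" "u = w @ v"
    by (auto simp: graft_def)
  then show "take n u \<in> graft w T"
  proof cases
    case 1
    then have "min n k < length w" "take n u = take (min n k) w" by auto
    then show ?thesis unfolding graft_def by blast
  next
    case 2
    then have v: "take m v \<in> T" for m using assms by (auto simp: is_tree_def)
    show ?thesis
    proof (cases "n < length w")
      case True
      then have "take n u = take n w" using 2 by simp
      then show ?thesis unfolding graft_def using True by blast
    next
      case False
      then have "take n u = w @ take (n - length w) v" using 2 by simp
      then show ?thesis unfolding graft_def using v by blast
    qed
  qed
qed

lemma map_append_seq: "map (append_seq w y) [0..<length w + l] = w @ map y [0..<l]"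
  by (intro nth_equalityI) (auto simp: append_seq_def nth_append)

lemma append_seq_in_paths:
  assumes "is_tree T" "y \<in> paths (subtree w T)" shows "append_seq w y \<in> paths T"
  unfolding paths_def
proof (intro CollectI allI)
  fix n
  have "map (append_seq w y) [0..<length w + n] \<in> T"
    using assms(2) by (simp add: map_append_seq paths_def subtree_def)
  then have "take n (map (append_seq w y) [0..<length w + n]) \<in> T"
    using assms(1) unfolding is_tree_def by blast
  then show "map (append_seq w y) [0..<n] \<in> T" by (simp add: take_map)
qed

lemma paths_graftE:
  assumes T: "is_tree T" and x: "x \<in> paths (graft w T)"
  obtains y where "y \<in> paths T" "x = append_seq w y"
proof
  let ?y = "\<lambda>i. x (length w + i)"
  \<comment> \<open>The extra letter of \<open>Suc l\<close> makes the segment longer than every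
    prefix of \<open>w\<close>, so it lies in the grafted part; closure under prefixes drops the
    letter again.\<close>
  have step: "map x [0..<length w] = w \<and> map ?y [0..<Suc l] \<in> T" for l
  proof -
    have "map x [0..<length w + Suc l] \<in> graft w T" using x unfolding paths_def by blast
    moreover have "map x [0..<length w + Suc l] \<noteq> take k w" for k
    proof
      assume "map x [0..<length w + Suc l] = take k w"
      from arg_cong[OF this, of length] show False by simp
    qed
    ultimately obtain v where v: "v \<in> T" "map x [0..<length w + Suc l] = w @ v"
      by (auto simp: graft_def)
    have "map x [0..<length w + Suc l] = map x [0..<length w] @ map ?y [0..<Suc l]"
      by (intro nth_equalityI) (auto simp: nth_append simp del: upt_Suc)
    with v have "map x [0..<length w] = w" "map ?y [0..<Suc l] = v" by auto
    with v show ?thesis by simp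
  qed
  have "map ?y [0..<l] \<in> T" for l
  proof -
    have "map ?y [0..<l] @ [?y l] \<in> T" using step[of l] by simp
    then show ?thesis by (rule is_treeD[OF T])
  qed
  then show "?y \<in> paths T" by (simp add: paths_def)
  show "x = append_seq w ?y"
  proof
    fix n
    have "x n = w ! n" if "n < length w"
    proof -
      have "map x [0..<length w] ! n = x n" using that by simp
      then show ?thesis using step[of 0] by simp
    qed
    then show "x n = append_seq w ?y n" by (auto simp: append_seq_def)
  qed
qed

text \<open>Every node at height \<open>l + m\<close> is a node at height \<open>l\<close>, by
  closure under prefixes, followed by a node of the subtree there.\<close>

lemma card_level_add:
  assumes "is_tree T"
  shows "card (level T (l + m)) \<le> (\<Sum>v\<in>level T l. card (level (subtree v T) m))"
proof -
  have "level T (l + m) \<subseteq> (\<lambda>(v, u). v @ u) ` (SIGMA v:level T l. level (subtree v T) m)"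
  proof
    fix w assume w: "w \<in> level T (l + m)"
    then have "w = (\<lambda>(v, u). v @ u) (take l w, drop l w)" by simp
    moreover have "(take l w, drop l w) \<in> (SIGMA v:level T l. level (subtree v T) m)"
      using w assms by (auto simp: level_def subtree_def is_tree_def)
    ultimately show "w \<in> (\<lambda>(v, u). v @ u) ` (SIGMA v:level T l. level (subtree v T) m)" by blast
  qed
  then have "card (level T (l + m)) \<le> card ((\<lambda>(v, u). v @ u) ` (SIGMA v:level T l. level (subtree v T) m))"
    by (intro card_mono finite_imageI finite_SigmaI) auto
  also have "\<dots> \<le> card (SIGMA v:level T l. level (subtree v T) m)"
    by (intro card_image_le finite_SigmaI) auto
  finally show ?thesis by simp
qed

section \<open>Measure of cylinders, levels and paths\<close>

lemma prob_space_mu_Cantor: "prob_space mu_Cantor"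
  unfolding mu_Cantor_def by (intro prob_space_PiM prob_space_measure_pmf)

lemma measure_cylinder:
  "{x. map x [0..<length w] = w} \<in> sets mu_Cantor"
  "measure mu_Cantor {x. map x [0..<length w] = w} = 1 / 2 ^ length w"
proof -
  let ?M = "\<lambda>_::nat. measure_pmf (bernoulli_pmf (1/2))"
  have iff: "map x [0..<length w] = w \<longleftrightarrow> (\<forall>i<length w. x i = w ! i)" for x
    unfolding list_eq_iff_nth_eq by simp
  have eq: "{x. map x [0..<length w] = w} = prod_emb UNIV ?M {..<length w} (Pi\<^sub>E {..<length w} (\<lambda>i. {w ! i}))"
    by (intro set_eqI) (auto simp: prod_emb_iff iff restrict_PiE_iff Pi_iff)
  show "{x. map x [0..<length w] = w} \<in> sets mu_Cantor"
    unfolding eq mu_Cantor_def by (intro sets_PiM_I) auto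
  have half: "emeasure (measure_pmf (bernoulli_pmf (1/2))) {b} = ennreal (1/2)" for b
    unfolding emeasure_pmf_single by (cases b) simp_all
  have "emeasure mu_Cantor {x. map x [0..<length w] = w} = (\<Prod>i<length w. emeasure (?M i) {w ! i})"
    unfolding eq mu_Cantor_def by (rule emeasure_PiM_emb) (auto intro: prob_space_measure_pmf)
  also have "\<dots> = ennreal ((1/2) ^ length w)"
    unfolding half by (simp only: prod_constant card_lessThan) (rule ennreal_power, simp)
  finally show "measure mu_Cantor {x. map x [0..<length w] = w} = 1 / 2 ^ length w"
    by (simp add: measure_def power_divide)
qed

lemma measure_level:
  "{x. map x [0..<l] \<in> T} \<in> sets mu_Cantor"
  "measure mu_Cantor {x. map x [0..<l] \<in> T} = card (level T l) / 2 ^ l"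
proof -
  interpret prob_space mu_Cantor by (rule prob_space_mu_Cantor)
  have eq: "{x. map x [0..<l] \<in> T} = (\<Union>w\<in>level T l. {x. map x [0..<length w] = w})"
    by (auto simp: level_def)
  show "{x. map x [0..<l] \<in> T} \<in> sets mu_Cantor"
    unfolding eq by (intro sets.finite_UN measure_cylinder finite_level)
  have "measure mu_Cantor {x. map x [0..<l] \<in> T} = (\<Sum>w\<in>level T l. measure mu_Cantor {x. map x [0..<length w] = w})"
    unfolding eq
  proof (rule finite_measure_finite_Union)
    show "disjoint_family_on (\<lambda>w. {x. map x [0..<length w] = w}) (level T l)"
      unfolding disjoint_family_on_def level_def by auto
  qed (auto intro: measure_cylinder)
  also have "\<dots> = (\<Sum>w\<in>level T l. 1 / 2 ^ l)"
    by (intro sum.cong refl, subst measure_cylinder(2)) (auto simp: level_def)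
  finally show "measure mu_Cantor {x. map x [0..<l] \<in> T} = card (level T l) / 2 ^ l" by simp
qed

text \<open>The sets of sequences passing through level \<open>l\<close> decrease to the set of
  paths, so continuity from above applies.\<close>

lemma level_ratio_tendsto:
  assumes "is_tree T"
  shows "decseq (\<lambda>l. real (card (level T l)) / 2 ^ l)"
    and "(\<lambda>l. real (card (level T l)) / 2 ^ l) \<longlonglongrightarrow> measure mu_Cantor (paths T)"
proof -
  interpret prob_space mu_Cantor by (rule prob_space_mu_Cantor)
  let ?A = "\<lambda>l. {x. map x [0..<l] \<in> T}"
  have dec: "decseq ?A"
    by (rule decseq_SucI) (auto intro: is_treeD[OF assms])
  then show "decseq (\<lambda>l. real (card (level T l)) / 2 ^ l)"
    unfolding measure_level(2)[symmetric] decseq_def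
    by (intro allI impI finite_measure_mono measure_level(1)) blast
  have "(\<lambda>l. measure mu_Cantor (?A l)) \<longlonglongrightarrow> measure mu_Cantor (\<Inter>l. ?A l)"
    using dec by (intro finite_Lim_measure_decseq) (auto intro: measure_level)
  moreover have "paths T = (\<Inter>l. ?A l)" by (auto simp: paths_def)
  ultimately show "(\<lambda>l. real (card (level T l)) / 2 ^ l) \<longlonglongrightarrow> measure mu_Cantor (paths T)" by (simp add: measure_level)
qed

lemma measure_paths_le:
  assumes "is_tree T" shows "measure mu_Cantor (paths T) * 2 ^ l \<le> card (level T l)"
  using decseq_ge[OF level_ratio_tendsto[OF assms], of l] by (simp add: field_simps)

text \<open>With \<open>measure_paths_le\<close>, this replaces measure by counting on finite
  levels.\<close>

lemma measure_paths_ge: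
  fixes c :: real
  assumes "is_tree T" "\<And>l. c * 2 ^ l \<le> card (level T l)"
  shows "c \<le> measure mu_Cantor (paths T)"
  by (rule LIMSEQ_le_const[OF level_ratio_tendsto(2)[OF assms(1)]]) (use assms(2) in \<open>auto simp: field_simps\<close>)

text \<open>The measure drops at most by the factor \<open>2 ^ length w\<close>. Within the stem a
  single node meets this bound since \<open>?M\<close> is at most 1; beyond it each level contains a
  copy of a level of \<open>T\<close>.\<close>

lemma measure_paths_graft:
  assumes T: "is_tree T" and pos: "0 < measure mu_Cantor (paths T)"
  shows "0 < measure mu_Cantor (paths (graft w T))"
proof -
  let ?M = "measure mu_Cantor (paths T)"
  have "?M / 2 ^ length w * 2 ^ l \<le> card (level (graft w T) l)" for l
  proof (cases "l < length w")
    case True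
    have "?M \<le> 1" by (rule prob_space.prob_le_1[OF prob_space_mu_Cantor])
    moreover have "(2::real) ^ l \<le> 2 ^ length w" using True by simp
    ultimately have "?M * 2 ^ l \<le> 1 * 2 ^ length w" by (intro mult_mono) auto
    then have "?M / 2 ^ length w * 2 ^ l \<le> 1" by (simp add: field_simps)
    moreover have "take l w \<in> level (graft w T) l" using True by (auto simp: level_def graft_def)
    then have "0 < card (level (graft w T) l)" by (auto simp: card_gt_0_iff)
    ultimately show ?thesis by linarith
  next
    case False
    then obtain j where l: "l = length w + j" by (metis le_Suc_ex not_less)
    have "card (level T j) \<le> card (level (graft w T) l)"
      by (rule card_inj_on_le[of "\<lambda>v. w @ v"]) (auto simp: inj_on_def level_def graft_def l)
    with measure_paths_le[OF T, of j] show ?thesis by (simp add: l power_add)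
  qed
  from measure_paths_ge[OF is_tree_graft[OF T] this] pos show ?thesis
    by (meson divide_pos_pos less_le_trans zero_less_numeral zero_less_power)
qed

text \<open>A replacement for the Lebesgue density theorem: pick a level whose clopen hull
  exceeds the measure of the paths by a factor less than \<open>1 / c\<close>; then the average
  relative measure of the subtrees at that level is more than \<open>c\<close>.\<close>

lemma dense_subtree:
  fixes c :: real
  assumes T: "is_tree T" and pos: "0 < measure mu_Cantor (paths T)" and c: "c < 1"
  obtains w where "\<And>l. c * 2 ^ l \<le> card (level (subtree w T) l)"
proof (rule ccontr)
  assume "\<not> thesis"
  then have "\<forall>w. \<exists>l. card (level (subtree w T) l) < c * 2 ^ l" using that by (force simp: not_le)
  then obtain f where f: "\<And>w. card (level (subtree w T) (f w)) < c * 2 ^ f w" by metis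
  let ?M = "measure mu_Cantor (paths T)"
  have "c * ?M < ?M" using pos c by simp
  moreover have "(\<lambda>l. c * (card (level T l) / 2 ^ l)) \<longlonglongrightarrow> c * ?M"
    by (intro tendsto_intros level_ratio_tendsto T)
  ultimately have "eventually (\<lambda>l. c * (card (level T l) / 2 ^ l) < ?M) sequentially"
    by (rule order_tendstoD(2)[rotated])
  then obtain l where l: "c * (card (level T l) / 2 ^ l) < ?M" by (auto simp: eventually_sequentially)
  \<comment> \<open>The density of a level decreases with its height, so all subtrees rooted at
    level \<open>l\<close> are still sparse at a common height above every \<open>f v\<close>; the
    sum is such a height.\<close>
  define m where "m = (\<Sum>v\<in>level T l. f v)"
  have le: "card (level (subtree v T) m) \<le> c * 2 ^ m" if "v \<in> level T l" for v
  proof -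
    have "f v \<le> m" unfolding m_def using that by (intro member_le_sum) auto
    then have "card (level (subtree v T) m) / 2 ^ m \<le> card (level (subtree v T) (f v)) / 2 ^ f v"
      by (rule decseqD[OF level_ratio_tendsto(1)[OF is_tree_subtree[OF T]]])
    also have "\<dots> \<le> c" using f[of v] by (simp add: field_simps)
    finally show ?thesis by (simp add: field_simps)
  qed
  have "?M * 2 ^ (l + m) \<le> card (level T (l + m))" by (rule measure_paths_le[OF T])
  also have "\<dots> \<le> real (\<Sum>v\<in>level T l. card (level (subtree v T) m))"
    using card_level_add[OF T] by (simp only: of_nat_le_iff)
  also have "\<dots> \<le> (\<Sum>v\<in>level T l. c * 2 ^ m)"
    unfolding of_nat_sum by (intro sum_mono le)
  also have "\<dots> = c * (card (level T l) / 2 ^ l) * 2 ^ (l + m)" by (simp add: power_add)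
  also have "\<dots> < ?M * 2 ^ (l + m)" using l by (intro mult_strict_right_mono) auto
  finally show False by simp
qed

section \<open>Weihrauch reductions pointwise\<close>

text \<open>Removes the quantifier over realizers: a reduction asks one question and must cope with
  any name of any solution.\<close>

definition reduces :: "(baire \<Rightarrow> baire option) \<Rightarrow> (baire \<Rightarrow> baire option) \<Rightarrow>
    ('a, 'b) problem \<Rightarrow> ('c, 'd) problem \<Rightarrow> bool" where
  "reduces H K P Q \<longleftrightarrow> (\<forall>p x. fst P p = Some x \<and> snd (snd P) x \<noteq> {} \<longrightarrow>
     (\<exists>k z. K p = Some k \<and> fst Q k = Some z \<and> snd (snd Q) z \<noteq> {} \<and>
       (\<forall>r y. fst (snd Q) r = Some y \<and> y \<in> snd (snd Q) z \<longrightarrow>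
          (\<exists>s v. H (pair_b p r) = Some s \<and> fst (snd P) s = Some v \<and> v \<in> snd (snd P) x))))"

lemma reducesD:
  assumes "reduces H K P Q" "fst P p = Some x" "snd (snd P) x \<noteq> {}"
  obtains k z where "K p = Some k" "fst Q k = Some z" "snd (snd Q) z \<noteq> {}"
    "\<And>r y. fst (snd Q) r = Some y \<Longrightarrow> y \<in> snd (snd Q) z \<Longrightarrow>
       \<exists>s v. H (pair_b p r) = Some s \<and> fst (snd P) s = Some v \<and> v \<in> snd (snd P) x"
  using assms unfolding reduces_def by blast

lemma realizes_iff:
  "realizes P F \<longleftrightarrow> (\<forall>p x. fst P p = Some x \<and> snd (snd P) x \<noteq> {} \<longrightarrow>
     (\<exists>q y. F p = Some q \<and> fst (snd P) q = Some y \<and> y \<in> snd (snd P) x))"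
  by (simp add: realizes_def split: prod.split)

lemma W_leI:
  assumes "computable_pf H" "computable_pf K" "reduces H K P Q"
  shows "P \<le>\<^sub>W Q"
  unfolding W_le_def
proof (intro exI conjI allI impI)
  show "computable_pf H" "computable_pf K" by fact+
  fix G assume G: "realizes Q G"
  show "realizes P (\<lambda>p. Option.bind (K p) (\<lambda>k. Option.bind (G k) (\<lambda>r. H (pair_b p r))))"
    unfolding realizes_iff
  proof (intro allI impI, elim conjE)
    fix p x assume "fst P p = Some x" "snd (snd P) x \<noteq> {}"
    with assms(3) obtain k z where k: "K p = Some k" "fst Q k = Some z" "snd (snd Q) z \<noteq> {}"
      and H: "\<And>r y. fst (snd Q) r = Some y \<Longrightarrow> y \<in> snd (snd Q) z \<Longrightarrow>
       \<exists>s v. H (pair_b p r) = Some s \<and> fst (snd P) s = Some v \<and> v \<in> snd (snd P) x"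
      by (rule reducesD) blast
    obtain r y where "G k = Some r" "fst (snd Q) r = Some y" "y \<in> snd (snd Q) z"
      using G k unfolding realizes_iff by blast
    with H k show "\<exists>q y. Option.bind (K p) (\<lambda>k. Option.bind (G k) (\<lambda>r. H (pair_b p r))) = Some q \<and>
      fst (snd P) q = Some y \<and> y \<in> snd (snd P) x" by simp
  qed
qed

text \<open>The realizer quantified over in \<open>\<le>\<^sub>W\<close> may be taken undefined outside the domain of
  \<open>Q\<close> and arbitrary at one point of it.\<close>

lemma W_leE:
  assumes "P \<le>\<^sub>W Q" and surj: "\<And>y. \<exists>r. fst (snd Q) r = Some y"
  obtains H K where "computable_pf H" "computable_pf K" "reduces H K P Q"
proof -
  obtain H K where HK: "computable_pf H" "computable_pf K"
    and G: "\<And>G. realizes Q G \<Longrightarrow>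
      realizes P (\<lambda>p. Option.bind (K p) (\<lambda>k. Option.bind (G k) (\<lambda>r. H (pair_b p r))))"
    using assms(1) unfolding W_le_def by blast
  \<comment> \<open>Surjectivity of the output representation yields at least one realizer, without
    which \<open>G\<close> would be vacuous.\<close>
  have "\<exists>g. \<forall>k z. fst Q k = Some z \<and> snd (snd Q) z \<noteq> {} \<longrightarrow>
      (\<exists>y. fst (snd Q) (g k) = Some y \<and> y \<in> snd (snd Q) z)"
  proof (rule choice, rule allI)
    fix k
    show "\<exists>r. \<forall>z. fst Q k = Some z \<and> snd (snd Q) z \<noteq> {} \<longrightarrow>
      (\<exists>y. fst (snd Q) r = Some y \<and> y \<in> snd (snd Q) z)"
    proof (cases "\<exists>z. fst Q k = Some z \<and> snd (snd Q) z \<noteq> {}")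
      case True
      then obtain z y where zy: "fst Q k = Some z" "y \<in> snd (snd Q) z" by blast
      obtain r where "fst (snd Q) r = Some y" using surj by blast
      with zy show ?thesis by (intro exI[of _ r]) auto
    next
      case False
      then show ?thesis by simp
    qed
  qed
  then obtain g where g: "\<And>k z. fst Q k = Some z \<Longrightarrow> snd (snd Q) z \<noteq> {} \<Longrightarrow>
      \<exists>y. fst (snd Q) (g k) = Some y \<and> y \<in> snd (snd Q) z" by blast
  define D where "D = {k. \<exists>z. fst Q k = Some z \<and> snd (snd Q) z \<noteq> {}}"
  define G0 where "G0 k = (if k \<in> D then Some (g k) else None)" for k
  have G0: "realizes Q G0"
    unfolding realizes_iff
  proof (intro allI impI, elim conjE)
    fix k z assume z: "fst Q k = Some z" "snd (snd Q) z \<noteq> {}"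
    then have "G0 k = Some (g k)" by (auto simp: G0_def D_def)
    with g[OF z] show "\<exists>q y. G0 k = Some q \<and> fst (snd Q) q = Some y \<and> y \<in> snd (snd Q) z" by blast
  qed
  have "reduces H K P Q"
    unfolding reduces_def
  proof (intro allI impI, elim conjE)
    fix p x assume px: "fst P p = Some x" "snd (snd P) x \<noteq> {}"
    \<comment> \<open>Since \<open>G0\<close> is undefined off \<open>D\<close>, a defined composite
      forces \<open>K p\<close> to exist and to name an instance that has solutions.\<close>
    obtain s where "Option.bind (K p) (\<lambda>k. Option.bind (G0 k) (\<lambda>r. H (pair_b p r))) = Some s"
      using G[OF G0] px unfolding realizes_iff by blast
    then obtain k where k: "K p = Some k" "k \<in> D"
      by (auto simp: bind_eq_Some_conv G0_def split: if_splits)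
    then obtain z where z: "fst Q k = Some z" "snd (snd Q) z \<noteq> {}" unfolding D_def by blast
    have "\<exists>s v. H (pair_b p r) = Some s \<and> fst (snd P) s = Some v \<and> v \<in> snd (snd P) x"
      if ry: "fst (snd Q) r = Some y" "y \<in> snd (snd Q) z" for r y
    proof -
      have "realizes Q (G0(k := Some r))"
        unfolding realizes_iff
      proof (intro allI impI, elim conjE)
        fix k' z' assume z': "fst Q k' = Some z'" "snd (snd Q) z' \<noteq> {}"
        show "\<exists>q y. (G0(k := Some r)) k' = Some q \<and> fst (snd Q) q = Some y \<and> y \<in> snd (snd Q) z'"
        proof (cases "k' = k")
          case True
          with z z' ry show ?thesis by auto
        next
          case False
          then show ?thesis using G0 z' unfolding realizes_iff by simp
        qed
      qed
      from G[OF this, unfolded realizes_iff, rule_format, OF conjI[OF px]]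
      show ?thesis using k(1) by simp
    qed
    with k z show "\<exists>k z. K p = Some k \<and> fst Q k = Some z \<and> snd (snd Q) z \<noteq> {} \<and>
       (\<forall>r y. fst (snd Q) r = Some y \<and> y \<in> snd (snd Q) z \<longrightarrow>
          (\<exists>s v. H (pair_b p r) = Some s \<and> fst (snd P) s = Some v \<and> v \<in> snd (snd P) x))"
      by blast
  qed
  with HK that show thesis by blast
qed

section \<open>Discrete limits and names\<close>

lemma lim_Delta_eqI:
  assumes "\<And>i. N \<le> i \<Longrightarrow> seq_of r i = t" shows "lim_Delta r = Some t"
proof -
  let ?P = "\<lambda>N. \<forall>i\<ge>N. seq_of r i = seq_of r N"
  have ex: "?P N" using assms by simp
  define M where "M = (SOME N. ?P N)"
  have M: "?P M" unfolding M_def using ex by (rule someI)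
  have "lim_Delta r = Some (seq_of r M)"
    unfolding lim_Delta_def M_def by (rule if_P) (rule exI[of ?P, OF ex])
  moreover have "seq_of r (max N M) = seq_of r M" by (rule M[rule_format]) simp
  \<comment> \<open>\<open>SOME\<close> may pick a stabilisation point other than \<open>N\<close>;
    the two limits are compared at the larger index.\<close>
  moreover have "seq_of r (max N M) = t" by (rule assms) simp
  ultimately show ?thesis by (simp only:)
qed

lemma lim_DeltaE:
  assumes "lim_Delta r = Some t"
  obtains N where "\<And>i. N \<le> i \<Longrightarrow> seq_of r i = t"
proof (cases "\<exists>N. \<forall>i\<ge>N. seq_of r i = seq_of r N")
  case True
  then obtain N where N: "\<forall>i\<ge>N. seq_of r i = seq_of r N" by blast
  have "lim_Delta r = Some (seq_of r N)"
    by (rule lim_Delta_eqI[of N]) (rule N[rule_format])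
  with assms N show thesis by (intro that[of N]) (metis option.inject)
next
  case False
  then show thesis using assms unfolding lim_Delta_def by (metis option.distinct(1))
qed

lemma delta_TrD:
  "delta_Tr t = Some T \<Longrightarrow> T = {w. t (bl_code w) = 1} \<and> is_tree T \<and> (\<forall>n. t n \<le> 1)"
  by (auto simp: delta_Tr_def split: if_splits)

lemma delta_TrI:
  "(\<And>n. t n \<le> 1) \<Longrightarrow> is_tree T \<Longrightarrow> (\<And>w. t (bl_code w) = 1 \<longleftrightarrow> w \<in> T) \<Longrightarrow> delta_Tr t = Some T"
  by (simp add: delta_Tr_def)

lemma delta_CantorD: "delta_Cantor y = Some x \<Longrightarrow> x = (\<lambda>n. y n = 1) \<and> (\<forall>n. y n \<le> 1)"
  by (auto simp: delta_Cantor_def split: if_splits)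

lemma delta_Cantor_surj: "\<exists>y. delta_Cantor y = Some x"
  by (rule exI[of _ "\<lambda>n. of_bool (x n)"]) (simp add: delta_Cantor_def)

section \<open>Compositions reduce to the jump\<close>

definition marker :: "nat \<Rightarrow> bool list" where
  "marker n = replicate n False @ [True]"

text \<open>Solves \<open>j = bl_code (marker n @ v)\<close> for \<open>c = bl_code v\<close>.
  Without a solution the search returns \<open>Suc j\<close>, which the test
  \<open>graft_index n j \<le> j\<close> detects.\<close>

definition graft_index :: "nat \<Rightarrow> nat \<Rightarrow> nat" where
  "graft_index n j = search (Suc j) (\<lambda>c. Suc j = 2 ^ n * (3 + 2 * c))"

text \<open>Values are shifted by one as in \<open>look\<close>, with 0 for an entry not yet known.
  \<open>Suc j = 2 ^ k\<close> says that \<open>j\<close> codes the word of \<open>k\<close> zeros;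
  for \<open>k \<le> n\<close> these are the proper prefixes of the marker.\<close>

definition graft_look :: "nat \<Rightarrow> nat \<Rightarrow> nat list \<Rightarrow> nat" where
  "graft_look n j \<tau> = (if \<exists>k<Suc n. Suc j = 2 ^ k then 2
     else if graft_index n j \<le> j then look \<tau> (graft_index n j) else 1)"

definition graft_name :: "nat \<Rightarrow> baire \<Rightarrow> baire" where
  "graft_name n t j = (if \<exists>k<Suc n. Suc j = 2 ^ k then 1
     else if graft_index n j \<le> j then t (graft_index n j) else 0)"

lemma length_marker [simp]: "length (marker n) = Suc n"
  by (simp add: marker_def)

lemma computable_graft_look [comp_intro]:
  assumes "computable f" "computable g" "computable h"
  shows "computable (\<lambda>x. graft_look (f x) (g x) (h x))"
  unfolding graft_look_def graft_index_def
  by (intro comp_intro assms computable_comp[OF assms(1)] computable_comp[OF assms(2)] computable_comp[OF assms(3)])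

lemma graft_look_pref:
  "0 < graft_look n j (pref t l) \<Longrightarrow> graft_look n j (pref t l) = Suc (graft_name n t j)"
  "j < l \<Longrightarrow> 0 < graft_look n j (pref t l)"
  by (auto simp: graft_look_def graft_name_def look_pref split: if_splits)

lemma delta_Tr_graft_name:
  assumes "delta_Tr t = Some T"
  shows "delta_Tr (graft_name n t) = Some (graft (marker n) T)"
proof (rule delta_TrI)
  note T = delta_TrD[OF assms]
  show "graft_name n t j \<le> 1" for j using T by (auto simp: graft_name_def)
  show "is_tree (graft (marker n) T)" using T is_tree_graft by blast
  fix u
  have 1: "(\<exists>k<Suc n. Suc (bl_code u) = 2 ^ k) \<longleftrightarrow> (\<exists>k<length (marker n). u = take k (marker n))"
    unfolding length_marker
  proof (intro ex_cong1 conj_cong refl)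
    fix k assume "k < Suc n"
    then have "take k (marker n) = replicate k False" by (simp add: marker_def min_def)
    then show "Suc (bl_code u) = 2 ^ k \<longleftrightarrow> u = take k (marker n)"
      unfolding bl_code_replicate[symmetric] by simp
  qed
  have code: "Suc (bl_code (marker n @ v)) = 2 ^ n * (3 + 2 * bl_code v)" for v
  proof -
    have "bl_code (marker n @ v) = bl_code (replicate n False) + 2 ^ n * (2 + 2 * bl_code v)"
      by (simp add: marker_def bl_code_append)
    then have "Suc (bl_code (marker n @ v)) = 2 ^ n + 2 ^ n * (2 + 2 * bl_code v)"
      using bl_code_replicate[of n] by linarith
    then show ?thesis by (simp add: algebra_simps)
  qed
  have le: "bl_code v \<le> bl_code (marker n @ v)" for v
  proof -
    have "1 * bl_code v \<le> 2 ^ length (marker n) * bl_code v" by (intro mult_le_mono1) simp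
    then show ?thesis unfolding bl_code_append by linarith
  qed
  have index: "graft_index n (bl_code (marker n @ v)) = bl_code v" for v
    unfolding graft_index_def
  proof (rule search_eqI)
    show "Suc (bl_code (marker n @ v)) = 2 ^ n * (3 + 2 * bl_code v)" by (rule code)
    show "bl_code v < Suc (bl_code (marker n @ v))" using le[of v] by (simp only: less_Suc_eq_le)
    show "Suc (bl_code (marker n @ v)) \<noteq> 2 ^ n * (3 + 2 * i)" if "i < bl_code v" for i
      unfolding code using that by simp
  qed
  have ex: "\<exists>v. u = marker n @ v" if "graft_index n (bl_code u) \<le> bl_code u"
  proof -
    obtain v where v: "bl_code v = graft_index n (bl_code u)" using bl_code_surj by blast
    have "graft_index n (bl_code u) < Suc (bl_code u)" using that by simp
    then have "Suc (bl_code u) = 2 ^ n * (3 + 2 * graft_index n (bl_code u))"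
      unfolding graft_index_def by (rule search_found)
    then have "Suc (bl_code u) = Suc (bl_code (marker n @ v))" unfolding code v .
    then have "u = marker n @ v" by (simp only: nat.inject bl_code_eq_iff)
    then show ?thesis ..
  qed
  show "graft_name n t (bl_code u) = 1 \<longleftrightarrow> u \<in> graft (marker n) T"
  proof (cases "\<exists>k<Suc n. Suc (bl_code u) = 2 ^ k")
    case True
    then have "graft_name n t (bl_code u) = 1" unfolding graft_name_def by (simp only: if_True)
    moreover have "u \<in> graft (marker n) T" using True 1 unfolding graft_def by blast
    ultimately show ?thesis by blast
  next
    case False
    then have "u \<in> graft (marker n) T \<longleftrightarrow> (\<exists>v\<in>T. u = marker n @ v)"
      using 1 unfolding graft_def by blast
    moreover have "graft_name n t (bl_code u) = 1 \<longleftrightarrow> (\<exists>v\<in>T. u = marker n @ v)"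
    proof (cases "graft_index n (bl_code u) \<le> bl_code u")
      case True
      with ex obtain v where u: "u = marker n @ v" by blast
      have "graft_name n t (bl_code u) = t (bl_code v)"
        unfolding graft_name_def if_not_P[OF False] if_P[OF True] unfolding u index ..
      then show ?thesis using T u by auto
    next
      case nle: False
      have "graft_name n t (bl_code u) = 0"
        unfolding graft_name_def if_not_P[OF False] if_not_P[OF nle] ..
      moreover have "u \<noteq> marker n @ v" for v using nle index[of v] le[of v] by metis
      ultimately show ?thesis by simp
    qed
    ultimately show ?thesis by blast
  qed
qed

text \<open>Of the two successors, one comes from \<open>look\<close> and one from the enumeration
  of the complement. A prefix excludes at most as many numbers as it has entries, so the search
  always succeeds.\<close>

definition guess :: "nat list \<Rightarrow> nat" where
  "guess \<alpha> = search (Suc (length \<alpha>)) (\<lambda>n. \<not> (\<exists>i<length \<alpha>. look \<alpha> i = Suc (Suc n)))"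

lemma computable_guess [comp_intro]:
  assumes "computable f" shows "computable (\<lambda>x. guess (f x))"
  unfolding guess_def by (intro comp_intro assms computable_comp[OF assms])

text \<open>The guesses settle on the least element of the set once all smaller numbers have been
  enumerated.\<close>

lemma guess_eventually:
  assumes "\<forall>k. a k \<noteq> Suc m"
  obtains n N where "\<forall>k. a k \<noteq> Suc n" "\<And>i. N \<le> i \<Longrightarrow> guess (pref a i) = n"
proof -
  define n where "n = (LEAST n. \<forall>k. a k \<noteq> Suc n)"
  have n: "\<forall>k. a k \<noteq> Suc n" unfolding n_def using assms by (rule LeastI)
  have "\<exists>k. a k = Suc i" if "i < n" for i using not_less_Least that unfolding n_def by blast
  then obtain f where f: "\<And>i. i < n \<Longrightarrow> a (f i) = Suc i" by metis
  \<comment> \<open>Beyond the sum every position \<open>f m\<close> with \<open>m < n\<close> has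
    been read; the summand \<open>n\<close> keeps \<open>n\<close> within the range of the
    search.\<close>
  have "guess (pref a i) = n" if i: "n + Suc (sum f {..<n}) \<le> i" for i
    unfolding guess_def
  proof (rule search_eqI)
    show "\<not> (\<exists>j<length (pref a i). look (pref a i) j = Suc (Suc n))" using n by (simp add: look_pref)
    show "n < Suc (length (pref a i))" using i by simp
    fix m assume m: "m < n"
    then have "f m \<le> sum f {..<n}" by (intro member_le_sum) auto
    then have "f m < i" using i by simp
    then show "\<not> \<not> (\<exists>j<length (pref a i). look (pref a i) j = Suc (Suc m))"
      using f[OF m] by (auto simp: look_pref)
  qed
  with n that show thesis by blast
qed

text \<open>Recovers the number in the marker: \<open>z\<close> pairs an instance with a path, so
  the path sits at the odd positions.\<close>

definition first_one :: "baire \<Rightarrow> baire option" where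
  "first_one z = (if \<exists>i. z (Suc (2 * i)) = 1 then Some (\<lambda>_. LEAST i. z (Suc (2 * i)) = 1) else None)"

definition after_first_one :: "baire \<Rightarrow> baire option" where
  "after_first_one z = map_option (\<lambda>n m. z (Suc (2 * (Suc (n 0) + m)))) (first_one z)"

text \<open>A prefix of length \<open>k\<close> shows exactly \<open>k div 2\<close> odd positions.
  The search among them either fails or finds the true first 1, never a wrong position.\<close>

lemma search_one_pref:
  assumes "first_one z = Some n"
  shows "search (k div 2) (\<lambda>i. look (pref z k) (Suc (2 * i)) = 2) < k div 2 \<longleftrightarrow> n 0 < k div 2"
    "search (k div 2) (\<lambda>i. look (pref z k) (Suc (2 * i)) = 2) < k div 2 \<Longrightarrow>
      search (k div 2) (\<lambda>i. look (pref z k) (Suc (2 * i)) = 2) = n 0"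
proof -
  let ?P = "\<lambda>i. z (Suc (2 * i)) = 1"
  from assms have n: "n 0 = (LEAST i. ?P i)" "?P (n 0)"
    by (auto simp: first_one_def split: if_splits intro: LeastI)
  let ?s = "search (k div 2) (\<lambda>i. look (pref z k) (Suc (2 * i)) = 2)"
  have look: "look (pref z k) (Suc (2 * i)) = 2 \<longleftrightarrow> ?P i" if "i < k div 2" for i
    using that by (auto simp: look_pref)
  have eq: "?s = n 0" if "n 0 < k div 2"
    using that n look not_less_Least[of _ ?P] by (intro search_eqI) auto
  have lt: "n 0 < k div 2" if "?s < k div 2"
  proof -
    have "?P ?s" using search_found[OF that] look[OF that] by blast
    then show ?thesis using that Least_le[of ?P ?s] n by simp
  qed
  show "?s < k div 2 \<longleftrightarrow> n 0 < k div 2" "?s < k div 2 \<Longrightarrow> ?s = n 0" using eq lt by auto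
qed

lemma computable_pf_first_one: "computable_pf first_one"
proof (rule computable_pfI)
  let ?s = "\<lambda>x. search (length (snd x) div 2) (\<lambda>i. look (snd x) (Suc (2 * i)) = 2)"
  let ?\<phi> = "\<lambda>x :: nat \<times> nat list. if ?s x < length (snd x) div 2 then Suc (?s x) else 0"
  show "computable ?\<phi>" by (intro comp_intro)
  fix z q n assume z: "first_one z = Some q"
  then have q: "q n = q 0" by (auto simp: first_one_def split: if_splits)
  show "\<exists>k. 0 < ?\<phi> (n, pref z k)"
    using search_one_pref(1)[OF z, of "2 * Suc (q 0)"] by (intro exI[of _ "2 * Suc (q 0)"]) simp
  show "?\<phi> (n, pref z k) = Suc (q n)" if "0 < ?\<phi> (n, pref z k)" for k
    using that search_one_pref(2)[OF z, of k] q by (auto split: if_splits)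
qed

lemma computable_pf_after_first_one: "computable_pf after_first_one"
proof (rule computable_pfI)
  let ?s = "\<lambda>x. search (length (snd x) div 2) (\<lambda>i. look (snd x) (Suc (2 * i)) = 2)"
  let ?\<phi> = "\<lambda>x :: nat \<times> nat list. if ?s x < length (snd x) div 2
    then look (snd x) (Suc (2 * (Suc (?s x) + fst x))) else 0"
  show "computable ?\<phi>" by (intro comp_intro)
  fix z q m assume "after_first_one z = Some q"
  then obtain n where z: "first_one z = Some n" and q: "q m = z (Suc (2 * (Suc (n 0) + m)))"
    by (auto simp: after_first_one_def)
  let ?k = "2 * (Suc (Suc (n 0)) + m)"
  have "search (?k div 2) (\<lambda>i. look (pref z ?k) (Suc (2 * i)) = 2) < ?k div 2"
    using search_one_pref(1)[OF z, of ?k] by simp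
  then have "0 < ?\<phi> (m, pref z ?k)"
    using search_one_pref(2)[OF z, of ?k] by (simp add: look_pref del: nonzero_mult_div_cancel_left)
  then show "\<exists>k. 0 < ?\<phi> (m, pref z k)" ..
  show "?\<phi> (m, pref z k) = Suc (q m)" if "0 < ?\<phi> (m, pref z k)" for k
    using that search_one_pref(2)[OF z, of k] q by (auto simp: look_pref split: if_splits)
qed

lemma first_one_marker:
  assumes "delta_Cantor y = Some (append_seq (marker n) x)"
  shows "first_one (pair_b p y) = Some (\<lambda>_. n)"
    "\<exists>y'. after_first_one (pair_b p y) = Some y' \<and> delta_Cantor y' = Some x"
proof -
  note y = delta_CantorD[OF assms]
  have y1: "y i = 1 \<longleftrightarrow> append_seq (marker n) x i" for i using y by meson
  have yn: "y n = 1" unfolding y1 by (simp add: append_seq_def marker_def nth_append)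
  moreover have "(LEAST i. y i = 1) = n"
  proof (rule Least_equality)
    show "y n = 1" by (rule yn)
    show "n \<le> i" if "y i = 1" for i
      using that unfolding y1 by (auto simp: append_seq_def marker_def nth_append split: if_splits)
  qed
  ultimately show f: "first_one (pair_b p y) = Some (\<lambda>_. n)" by (auto simp: first_one_def)
  have "(\<lambda>m. y (Suc n + m) = 1) = x" unfolding y1 by (simp add: append_seq_def)
  moreover have "\<forall>m. y (Suc n + m) \<le> 1" using y by blast
  ultimately have "delta_Cantor (\<lambda>m. y (Suc n + m)) = Some x"
    unfolding delta_Cantor_def by (simp only: simp_thms if_True)
  then show "\<exists>y'. after_first_one (pair_b p y) = Some y' \<and> delta_Cantor y' = Some x"
    by (simp add: after_first_one_def f pair_b_simps(2) del: mult_Suc_right)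
qed

text \<open>Entry \<open>\<langle>i, j\<rangle>\<close> of the discretely converging sequence of trees: stage \<open>i\<close> works with the
  element \<open>n\<close> guessed from the first \<open>i\<close> values enumerated by \<open>kg\<close>, and stops with the value \<open>0\<close>
  as soon as this guess is refuted, so that every entry is defined. Grafting the tree onto
  \<open>marker n\<close> makes every path reveal the final guess.\<close>

definition stage :: "(nat list \<Rightarrow> nat list) \<Rightarrow> (nat list \<Rightarrow> nat list) \<Rightarrow> nat \<times> nat list \<Rightarrow> nat" where
  "stage kg h x =
    (if length (kg (snd x)) < fst (prod_decode (fst x)) then 0
     else if guess (take (fst (prod_decode (fst x))) (kg (snd x))) \<noteq> guess (kg (snd x)) then 1
     else graft_look (guess (kg (snd x))) (snd (prod_decode (fst x)))
       (h (weave (snd x) (map (\<lambda>_. guess (kg (snd x))) [0..<length (snd x)]))))"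

lemma computable_stage:
  assumes "computable kg" "computable h" shows "computable (stage kg h)"
  unfolding stage_def[abs_def] by (intro comp_intro computable_comp[OF assms(1)] computable_comp[OF assms(2)])

text \<open>Before stage \<open>N\<close> answers may vary with the prefix, which is why
  \<open>run\<close> keeps the first one; from stage \<open>N\<close> on every positive answer is
  the successor of the entry of the grafted name.\<close>

lemma lim_Delta_run_stage:
  assumes kg: "tracks kg Kg" "Kg p = Some a"
    and N: "\<And>i. N \<le> i \<Longrightarrow> guess (pref a i) = n"
    and h: "tracks h F" "F (pair_b p (\<lambda>_. n)) = Some t"
  obtains r where "run (stage kg h) p = Some r" "lim_Delta r = Some (graft_name n t)"
proof -
  define len where "len k = length (kg (pref p k))" for k
  have kgp: "kg (pref p k) = pref a (len k)" for k unfolding len_def by (rule tracksD(2)[OF kg(1), OF kg(2)])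
  have hp: "h (weave (pref p k) (map (\<lambda>_. n) [0..<k])) = pref t (length (h (pref (pair_b p (\<lambda>_. n)) (2 * k))))" for k
  proof -
    have eq: "weave (pref p k) (map (\<lambda>_. n) [0..<k]) = pref (pair_b p (\<lambda>_. n)) (2 * k)"
      using weave_pref[of p k "\<lambda>_. n" k] by (simp add: pref_def)
    show ?thesis unfolding eq by (rule tracksD(2)[OF h(1), OF h(2)])
  qed
  have st: "stage kg h (prod_encode (i, j), pref p k) =
    (if len k < i then 0 else if guess (pref a i) \<noteq> guess (pref a (len k)) then 1
     else graft_look (guess (pref a (len k))) j (h (weave (pref p k) (map (\<lambda>_. guess (pref a (len k))) [0..<k]))))" for i j k
    by (simp add: stage_def kgp take_pref min_def)
  have ex: "\<exists>k. 0 < stage kg h (m, pref p k)" for m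
  proof -
    obtain i j where "prod_decode m = (i, j)" by (cases "prod_decode m")
    then have m: "m = prod_encode (i, j)" using prod_decode_inverse[of m] by simp
    have "\<exists>k0. \<forall>k\<ge>k0. max i N \<le> len k"
      unfolding len_def by (rule tracksD(3)[OF kg(1), OF kg(2)])
    then obtain k0 where k0: "\<And>k. k0 \<le> k \<Longrightarrow> max i N \<le> len k" by blast
    have "\<exists>k1. \<forall>k\<ge>k1. Suc j \<le> length (h (pref (pair_b p (\<lambda>_. n)) k))"
      by (rule tracksD(3)[OF h(1), OF h(2)])
    then obtain k1 where k1: "\<And>k. k1 \<le> k \<Longrightarrow> Suc j \<le> length (h (pref (pair_b p (\<lambda>_. n)) k))" by blast
    \<comment> \<open>At this length the current guess is final and entry \<open>j\<close> of the
      tree is computed. Stage \<open>i\<close> then either shares the guess and yields the grafted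
      entry, or is abandoned and yields its default.\<close>
    let ?k = "max k0 k1"
    have "guess (pref a (len ?k)) = n" using N k0[of ?k] by simp
    moreover have "0 < graft_look n j (h (weave (pref p ?k) (map (\<lambda>_. n) [0..<?k])))"
      unfolding hp using k1[of "2 * ?k"] by (intro graft_look_pref(2)) (simp add: Suc_le_eq)
    ultimately have "0 < stage kg h (m, pref p ?k)" using k0[of ?k] by (simp add: m st)
    then show ?thesis ..
  qed
  define r where "r = (\<lambda>m. stage kg h (m, pref p (LEAST k. 0 < stage kg h (m, pref p k))) - 1)"
  have "run (stage kg h) p = Some r" using ex by (simp add: run_def r_def)
  moreover have "lim_Delta r = Some (graft_name n t)"
  proof (rule lim_Delta_eqI)
    fix i assume i: "N \<le> i"
    have val: "stage kg h (prod_encode (i, j), pref p k) = Suc (graft_name n t j)"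
      if pos: "0 < stage kg h (prod_encode (i, j), pref p k)" for j k
    proof -
      have "i \<le> len k" using pos by (auto simp: st split: if_splits)
      then have "stage kg h (prod_encode (i, j), pref p k)
        = graft_look n j (h (weave (pref p k) (map (\<lambda>_. n) [0..<k])))"
        using i N by (simp add: st)
      then show ?thesis using pos graft_look_pref(1) unfolding hp by metis
    qed
    have "r (prod_encode (i, j)) = graft_name n t j" for j
      unfolding r_def by (subst val[OF LeastI_ex[OF ex]]) simp
    then show "seq_of r i = graft_name n t" by (simp add: seq_of_def)
  qed
  ultimately show thesis by (rule that)
qed

lemma comp_le_djump_WWKL:
  assumes comp: "composable f0 g0" and f0: "f0 \<le>\<^sub>W eps_WWKL \<epsilon>" and g0: "g0 \<le>\<^sub>W C_N" and "0 \<le> \<epsilon>"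
  shows "comp_problem f0 g0 \<le>\<^sub>W djump WWKL"
proof -
  obtain Hf Kf where f: "computable_pf Hf" "computable_pf Kf" "reduces Hf Kf f0 (eps_WWKL \<epsilon>)"
    using f0 by (rule W_leE) (auto simp: eps_WWKL_def delta_Cantor_surj)
  obtain Hg Kg where g: "computable_pf Hg" "computable_pf Kg" "reduces Hg Kg g0 C_N"
    using g0 by (rule W_leE) (auto simp: C_N_def delta_nat_def intro!: exI[of _ "\<lambda>_. _"])
  obtain kg where kg: "tracks kg Kg" using g(2) computable_pf_tracks by blast
  obtain h where h: "tracks h (\<lambda>z. Option.bind (Hg z) Kf)"
    using computable_pf_bind[OF g(1) f(2)] computable_pf_tracks by blast
  \<comment> \<open>\<open>M\<close> recomputes the intermediate name from the instance and the
    number read off the path; \<open>H\<close> hands it, with the rest of the path, to the outer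
    reduction.\<close>
  define M where "M z = Option.bind (Option.bind (Some (\<lambda>n. z (2 * n)))
      (\<lambda>x. Option.bind (first_one z) (\<lambda>y. Some (pair_b x y)))) Hg" for z
  define H where "H z = Option.bind (Option.bind (M z)
      (\<lambda>x. Option.bind (after_first_one z) (\<lambda>y. Some (pair_b x y)))) Hf" for z
  have "computable_pf M" unfolding M_def[abs_def]
    by (intro computable_pf_bind computable_pf_pair computable_pf_fst computable_pf_first_one g)
  then have "computable_pf H" unfolding H_def[abs_def]
    by (intro computable_pf_bind computable_pf_pair computable_pf_after_first_one f)
  moreover have "computable_pf (run (stage kg h))"
    using kg h by (intro computable_pf_run computable_stage tracksD(1))
  moreover have "reduces H (run (stage kg h)) (comp_problem f0 g0) (djump WWKL)"
    unfolding reduces_def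
  proof (intro allI impI, elim conjE)
    fix p u assume p: "fst (comp_problem f0 g0) p = Some u"
      and ne: "snd (snd (comp_problem f0 g0)) u \<noteq> {}"
    from p have p: "fst g0 p = Some u" by (simp add: comp_problem_def)
    from ne have mv: "mv_comp (snd (snd f0)) (snd (snd g0)) u \<noteq> {}" by (simp add: comp_problem_def)
    then have gu: "snd (snd g0) u \<noteq> {}" and fx: "\<And>x. x \<in> snd (snd g0) u \<Longrightarrow> snd (snd f0) x \<noteq> {}"
      and res: "\<And>x v. x \<in> snd (snd g0) u \<Longrightarrow> v \<in> snd (snd f0) x \<Longrightarrow> v \<in> snd (snd (comp_problem f0 g0)) u"
      by (auto simp: mv_comp_def comp_problem_def split: if_splits)
    from reducesD[OF g(3) p gu] obtain a A where a: "Kg p = Some a" "fst C_N a = Some A" "snd (snd C_N) A \<noteq> {}"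
      and Hg: "\<And>r y. fst (snd C_N) r = Some y \<Longrightarrow> y \<in> snd (snd C_N) A \<Longrightarrow>
       \<exists>s v. Hg (pair_b p r) = Some s \<and> fst (snd g0) s = Some v \<and> v \<in> snd (snd g0) u" by blast
    from a obtain m where "\<forall>k. a k \<noteq> Suc m" by (auto simp: C_N_def delta_compl_enum_def)
    then obtain n N where n: "\<forall>k. a k \<noteq> Suc n" and N: "\<And>i. N \<le> i \<Longrightarrow> guess (pref a i) = n"
      by (rule guess_eventually) blast
    from n a have "n \<in> snd (snd C_N) A" by (auto simp: C_N_def delta_compl_enum_def)
    \<comment> \<open>\<open>Hg\<close> may treat different names of \<open>n\<close> differently.
      The constant name is also the one built into \<open>stage\<close> and returned by
      \<open>first_one\<close>, so the same \<open>q\<close> arises each time.\<close>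
    with Hg[of "\<lambda>_. n" n] obtain q x where q: "Hg (pair_b p (\<lambda>_. n)) = Some q"
      "fst (snd g0) q = Some x" "x \<in> snd (snd g0) u" by (auto simp: C_N_def delta_nat_def)
    from q(2) comp have "fst f0 q = Some x" by (simp add: composable_def)
    from reducesD[OF f(3) this fx[OF q(3)]] obtain t T where t: "Kf q = Some t" "fst (eps_WWKL \<epsilon>) t = Some T"
      "snd (snd (eps_WWKL \<epsilon>)) T \<noteq> {}"
      and Hf: "\<And>r y. fst (snd (eps_WWKL \<epsilon>)) r = Some y \<Longrightarrow> y \<in> snd (snd (eps_WWKL \<epsilon>)) T \<Longrightarrow>
       \<exists>s v. Hf (pair_b q r) = Some s \<and> fst (snd f0) s = Some v \<and> v \<in> snd (snd f0) x" by blast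
    from t(2,3) have T: "delta_Tr t = Some T" "\<epsilon> < measure mu_Cantor (paths T)"
      by (auto simp: eps_WWKL_def split: if_splits)
    have tree: "is_tree T" using delta_TrD[OF T(1)] by blast
    have "Option.bind (Hg (pair_b p (\<lambda>_. n))) Kf = Some t" by (simp add: q(1) t(1))
    then obtain r where r: "run (stage kg h) p = Some r" "lim_Delta r = Some (graft_name n t)"
      using lim_Delta_run_stage[OF kg a(1) N h] by blast
    have name: "fst (djump WWKL) r = Some (graft (marker n) T)"
      by (simp add: djump_def WWKL_def r delta_Tr_graft_name[OF T(1)])
    have pos: "0 < measure mu_Cantor (paths (graft (marker n) T))"
      using T(2) \<open>0 \<le> \<epsilon>\<close> by (intro measure_paths_graft[OF tree]) simp
    then have WT: "snd (snd (djump WWKL)) (graft (marker n) T) = paths (graft (marker n) T)"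
      by (simp add: djump_def WWKL_def)
    have ne: "paths (graft (marker n) T) \<noteq> {}" using pos by auto
    have "\<exists>s v. H (pair_b p y) = Some s \<and> fst (snd (comp_problem f0 g0)) s = Some v \<and>
        v \<in> snd (snd (comp_problem f0 g0)) u"
      if y: "fst (snd (djump WWKL)) y = Some x'" "x' \<in> paths (graft (marker n) T)" for y x'
    proof -
      obtain x'' where x'': "x'' \<in> paths T" "x' = append_seq (marker n) x''"
        using paths_graftE[OF tree y(2)] .
      from y(1) x'' have "delta_Cantor y = Some (append_seq (marker n) x'')"
        by (simp add: djump_def WWKL_def)
      note one = first_one_marker[OF this, of p]
      obtain y' where y': "after_first_one (pair_b p y) = Some y'" "delta_Cantor y' = Some x''"
        using one(2) by blast
      have "M (pair_b p y) = Some q" by (simp add: M_def one(1) q(1))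
      then have "H (pair_b p y) = Hf (pair_b q y')" by (simp add: H_def y'(1))
      moreover obtain s v where "Hf (pair_b q y') = Some s" "fst (snd f0) s = Some v" "v \<in> snd (snd f0) x"
        using Hf[of y' x''] y'(2) x''(1) T(2) by (auto simp: eps_WWKL_def)
      ultimately show ?thesis using res[OF q(3)] by (auto simp: comp_problem_def)
    qed
    with r(1) name WT ne show "\<exists>k z. run (stage kg h) p = Some k \<and> fst (djump WWKL) k = Some z \<and>
      snd (snd (djump WWKL)) z \<noteq> {} \<and>
      (\<forall>r y. fst (snd (djump WWKL)) r = Some y \<and> y \<in> snd (snd (djump WWKL)) z \<longrightarrow>
         (\<exists>s v. H (pair_b p r) = Some s \<and> fst (snd (comp_problem f0 g0)) s = Some v \<and>
            v \<in> snd (snd (comp_problem f0 g0)) u))"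
      by (intro exI[of _ r] exI[of _ "graft (marker n) T"]) auto
  qed
  ultimately show ?thesis by (rule W_leI)
qed

section \<open>The jump reduces to a composition\<close>

text \<open>A candidate \<open>\<langle>N, bl_code w\<rangle>\<close> is refuted by a change of the tree sequence \<open>\<sigma>\<close> after stage \<open>N\<close>, or by
  a level \<open>l\<close> of the subtree at \<open>w\<close> in which more than the fraction \<open>1 / 2 ^ m\<close> of all words is missing.\<close>

definition refuted :: "nat \<Rightarrow> nat list \<Rightarrow> nat \<Rightarrow> nat \<Rightarrow> nat \<Rightarrow> nat \<Rightarrow> nat \<Rightarrow> bool" where
  "refuted m \<sigma> N a i j l \<longleftrightarrow>
    N \<le> i \<and> look \<sigma> (prod_encode (i, j)) \<noteq> 0 \<and> look \<sigma> (prod_encode (N, j)) \<noteq> 0 \<and>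
      look \<sigma> (prod_encode (i, j)) \<noteq> look \<sigma> (prod_encode (N, j)) \<or>
    2 ^ l < 2 ^ m * (\<Sum>c<2 ^ l.
      let v = look \<sigma> (prod_encode (N, a + 2 ^ code_length a * (2 ^ l - 1 + c))) in
        if v = 0 \<or> v = 2 then 0 else 1 :: nat)"

text \<open>\<open>x\<close> codes a candidate \<open>s\<close>, the evidence \<open>i\<close>,
  \<open>j\<close>, \<open>l\<close> and a padding. The padding gives each piece of evidence
  arbitrarily large codes, hence arbitrarily long prefixes on which it is checked. The value 0
  enumerates nothing.\<close>

definition refutation :: "nat \<Rightarrow> nat list \<Rightarrow> nat \<Rightarrow> nat" where
  "refutation m \<sigma> x = (let e = prod_decode (fst (prod_decode x)); s = fst e; y = prod_decode (snd e) in
    if refuted m \<sigma> (fst (prod_decode s)) (snd (prod_decode s)) (fst (prod_decode (fst y))) (snd (prod_decode (fst y))) (snd y)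
    then Suc s else 0)"

definition refutations :: "nat \<Rightarrow> baire \<Rightarrow> baire" where
  "refutations m r = (\<lambda>x. refutation m (pref r x) x)"

lemma computable_pf_refutations: "computable_pf (\<lambda>r. Some (refutations m r))"
  unfolding refutations_def
  by (rule computable_pf_test) (unfold refutation_def refuted_def Let_def, intro comp_intro)

text \<open>Evidence valid on one prefix persists on all longer ones, and the padding reaches a long
  enough prefix, so testing on \<open>pref r x\<close> alone loses nothing.\<close>

lemma refutations_iff:
  "(\<exists>x. refutations m r x = Suc (prod_encode (N, a))) \<longleftrightarrow>
   (\<exists>i j l. (\<exists>k. \<forall>k'\<ge>k. refuted m (pref r k') N a i j l))"
proof -
  have val: "refutation m \<sigma> (prod_encode (prod_encode (prod_encode (N, a), prod_encode (prod_encode (i, j), l)), k))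
    = (if refuted m \<sigma> N a i j l then Suc (prod_encode (N, a)) else 0)" for \<sigma> N a i j l k
    by (simp add: refutation_def)
  have mono_look: "look (pref r k') n = look (pref r k) n" if "k \<le> k'" "look (pref r k) n \<noteq> 0" for k k' n
    using that by (auto simp: look_pref split: if_splits)
  have mono: "refuted m (pref r k') N a i j l" if "refuted m (pref r k) N a i j l" "k \<le> k'" for k k' i j l
  proof -
    let ?S = "\<lambda>k. \<Sum>c<2 ^ l. let v = look (pref r k) (prod_encode (N, a + 2 ^ code_length a * (2 ^ l - 1 + c))) in
        if v = 0 \<or> v = 2 then 0 else 1 :: nat"
    \<comment> \<open>Unread entries count as present, so the number of words known to be missing
      only grows with the prefix.\<close>
    have "?S k \<le> ?S k'"
      by (intro sum_mono) (use that(2) in \<open>auto simp: Let_def look_pref\<close>)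
    then have le: "2 ^ m * ?S k \<le> 2 ^ m * ?S k'" by (rule mult_le_mono2)
    show ?thesis
    proof (cases "2 ^ l < 2 ^ m * ?S k")
      case True
      from less_le_trans[OF this le] show ?thesis unfolding refuted_def by (rule disjI2)
    next
      case False
      with that(1) have "N \<le> i \<and> look (pref r k) (prod_encode (i, j)) \<noteq> 0 \<and> look (pref r k) (prod_encode (N, j)) \<noteq> 0 \<and>
          look (pref r k) (prod_encode (i, j)) \<noteq> look (pref r k) (prod_encode (N, j))"
        unfolding refuted_def by blast
      then show ?thesis unfolding refuted_def by (simp add: mono_look[OF that(2)])
    qed
  qed
  show ?thesis
  proof
    assume "\<exists>x. refutations m r x = Suc (prod_encode (N, a))"
    then obtain x where x: "refutations m r x = Suc (prod_encode (N, a))" ..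
    obtain e k where e: "prod_decode x = (e, k)" by (cases "prod_decode x")
    obtain s y where s: "prod_decode e = (s, y)" by (cases "prod_decode e")
    obtain z l where z: "prod_decode y = (z, l)" by (cases "prod_decode y")
    obtain i j where i: "prod_decode z = (i, j)" by (cases "prod_decode z")
    have "s = prod_encode (N, a) \<and> refuted m (pref r x) N a i j l"
      using x by (auto simp: refutations_def refutation_def e s z i split: if_splits)
    then show "\<exists>i j l. \<exists>k. \<forall>k'\<ge>k. refuted m (pref r k') N a i j l" using mono by blast
  next
    assume "\<exists>i j l. \<exists>k. \<forall>k'\<ge>k. refuted m (pref r k') N a i j l"
    then obtain i j l k where k: "\<And>k'. k \<le> k' \<Longrightarrow> refuted m (pref r k') N a i j l" by blast
    let ?x = "prod_encode (prod_encode (prod_encode (N, a), prod_encode (prod_encode (i, j), l)), k)"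
    have "refutations m r ?x = Suc (prod_encode (N, a))"
      using k[OF le_prod_encode_2] by (simp add: refutations_def val)
    then show "\<exists>x. refutations m r x = Suc (prod_encode (N, a))" ..
  qed
qed

text \<open>Defined for an arbitrary sequence, because the entry at a candidate stage need not name
  a tree.\<close>

definition missing :: "baire \<Rightarrow> bool list \<Rightarrow> nat \<Rightarrow> nat" where
  "missing t w l = card {v. length v = l \<and> t (bl_code (w @ v)) \<noteq> 1}"

lemma sum_missing:
  "(\<Sum>c<2 ^ l. if t (bl_code w + 2 ^ length w * (2 ^ l - 1 + c)) = 1 then 0 else 1 :: nat) = missing t w l"
proof -
  have "(\<Sum>c<2 ^ l. if t (bl_code w + 2 ^ length w * (2 ^ l - 1 + c)) = 1 then 0 else 1 :: nat)
    = (\<Sum>v | length v = l. if t (bl_code w + 2 ^ length w * bl_code v) = 1 then 0 else 1)"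
    by (rule sum_words[where g = "\<lambda>x. if t (bl_code w + 2 ^ length w * x) = 1 then 0 else 1"])
  also have "\<dots> = (\<Sum>v | length v = l \<and> t (bl_code (w @ v)) \<noteq> 1. 1)"
    by (intro sum.mono_neutral_cong_right) (auto simp: bl_code_append)
  finally show ?thesis by (simp add: missing_def)
qed

lemma card_level_missing:
  assumes "\<And>u. t (bl_code u) = 1 \<longleftrightarrow> u \<in> T"
  shows "card (level (subtree w T) l) + missing t w l = 2 ^ l"
proof -
  have "{v. length v = l} = level (subtree w T) l \<union> {v. length v = l \<and> t (bl_code (w @ v)) \<noteq> 1}"
    using assms by (auto simp: level_def subtree_def)
  moreover have "card (level (subtree w T) l \<union> {v. length v = l \<and> t (bl_code (w @ v)) \<noteq> 1})
      = card (level (subtree w T) l) + missing t w l"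
    unfolding missing_def
    by (rule card_Un_disjoint) (use assms in \<open>auto simp: level_def subtree_def intro: finite_subset[OF _ finite_words[of l]]\<close>)
  ultimately show ?thesis using card_words[of l] by simp
qed

text \<open>The integer comparison is what an algorithm can test; the density bound is what
  \<open>dense_subtree\<close> supplies and \<open>measure_paths_ge\<close> consumes.\<close>

lemma missing_le_iff:
  assumes "\<And>u. t (bl_code u) = 1 \<longleftrightarrow> u \<in> T"
  shows "2 ^ m * missing t w l \<le> 2 ^ l \<longleftrightarrow> (1 - (1 / 2) ^ m) * 2 ^ l \<le> real (card (level (subtree w T) l))"
proof -
  have "real (card (level (subtree w T) l) + missing t w l) = real (2 ^ l)"
    by (simp only: card_level_missing[OF assms])
  then have card: "real (card (level (subtree w T) l)) = 2 ^ l - real (missing t w l)" by simp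
  have "2 ^ m * missing t w l \<le> 2 ^ l \<longleftrightarrow> real (2 ^ m * missing t w l) \<le> real (2 ^ l)"
    by (rule of_nat_le_iff[symmetric])
  also have "\<dots> \<longleftrightarrow> real (missing t w l) \<le> (1 / 2) ^ m * 2 ^ l"
    by (simp add: power_divide field_simps)
  also have "\<dots> \<longleftrightarrow> (1 - (1 / 2) ^ m) * 2 ^ l \<le> real (card (level (subtree w T) l))"
    unfolding card left_diff_distrib by linarith
  finally show ?thesis .
qed

definition candidates :: "nat \<Rightarrow> baire \<Rightarrow> nat set" where
  "candidates m r = {n. \<forall>k. refutations m r k \<noteq> Suc n}"

lemma candidates_iff:
  "prod_encode (N, bl_code w) \<in> candidates m r \<longleftrightarrow>
    (\<forall>i\<ge>N. seq_of r i = seq_of r N) \<and> (\<forall>l. 2 ^ m * missing (seq_of r N) w l \<le> 2 ^ l)"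
proof -
  let ?a = "bl_code w"
  let ?S = "\<lambda>k l. \<Sum>c<2 ^ l. let v = look (pref r k) (prod_encode (N, ?a + 2 ^ code_length ?a * (2 ^ l - 1 + c))) in
        if v = 0 \<or> v = 2 then 0 else 1 :: nat"
  have le: "?S k l \<le> missing (seq_of r N) w l" for k l
    unfolding sum_missing[symmetric] by (intro sum_mono) (auto simp: Let_def look_pref seq_of_def code_length)
  \<comment> \<open>The sum dominates every position queried at level \<open>l\<close>, so all of
    them have been read and the approximation is exact.\<close>
  have eq: "?S k l = missing (seq_of r N) w l"
    if "Suc (\<Sum>c<2 ^ l. prod_encode (N, ?a + 2 ^ code_length ?a * (2 ^ l - 1 + c))) \<le> k" for k l
    unfolding sum_missing[symmetric]
  proof (rule sum.cong[OF refl])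
    fix c :: nat assume c: "c \<in> {..<2 ^ l}"
    let ?f = "\<lambda>c. prod_encode (N, ?a + 2 ^ code_length ?a * (2 ^ l - 1 + c))"
    have "?f c \<le> (\<Sum>c<2 ^ l. ?f c)" using c by (intro member_le_sum) auto
    then have "?f c < k" using that by simp
    then show "(let v = look (pref r k) (?f c) in if v = 0 \<or> v = 2 then 0 else 1 :: nat)
      = (if seq_of r N (?a + 2 ^ length w * (2 ^ l - 1 + c)) = 1 then 0 else 1)"
      by (simp add: Let_def look_pref seq_of_def code_length)
  qed
  have "(\<exists>i j l. \<exists>k. \<forall>k'\<ge>k. refuted m (pref r k') N ?a i j l) \<longleftrightarrow>
    (\<exists>i\<ge>N. seq_of r i \<noteq> seq_of r N) \<or> (\<exists>l. 2 ^ l < 2 ^ m * missing (seq_of r N) w l)"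
    (is "?L \<longleftrightarrow> ?R")
  proof
    assume ?L
    then obtain i j l k where ref: "refuted m (pref r k) N ?a i j l" by blast
    show ?R
    proof (cases "2 ^ l < 2 ^ m * ?S k l")
      case True
      also have "2 ^ m * ?S k l \<le> 2 ^ m * missing (seq_of r N) w l" using le by (rule mult_le_mono2)
      finally show ?thesis by blast
    next
      case False
      then have "N \<le> i" "seq_of r i j \<noteq> seq_of r N j"
        using ref unfolding refuted_def by (auto simp: look_pref seq_of_def split: if_splits)
      then show ?thesis by metis
    qed
  next
    assume ?R
    then show ?L
    proof
      assume "\<exists>i\<ge>N. seq_of r i \<noteq> seq_of r N"
      then obtain i j where i: "N \<le> i" "seq_of r i j \<noteq> seq_of r N j" by (metis ext)
      have "refuted m (pref r k') N ?a i j 0"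
        if "Suc (prod_encode (i, j) + prod_encode (N, j)) \<le> k'" for k'
        unfolding refuted_def using i that by (simp add: look_pref seq_of_def)
      then show ?thesis by blast
    next
      assume "\<exists>l. 2 ^ l < 2 ^ m * missing (seq_of r N) w l"
      then obtain l where "2 ^ l < 2 ^ m * missing (seq_of r N) w l" ..
      then have "refuted m (pref r k') N ?a 0 0 l"
        if "Suc (\<Sum>c<2 ^ l. prod_encode (N, ?a + 2 ^ code_length ?a * (2 ^ l - 1 + c))) \<le> k'" for k'
        unfolding refuted_def eq[OF that] by blast
      then show ?thesis by blast
    qed
  qed
  moreover have "prod_encode (N, ?a) \<in> candidates m r \<longleftrightarrow> \<not> ?L"
    unfolding refutations_iff[symmetric] candidates_def by blast
  ultimately have "prod_encode (N, ?a) \<in> candidates m r \<longleftrightarrow> \<not> ?R" by (rule trans[OF _ arg_cong[where f = Not], rotated])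
  then show ?thesis unfolding not_le[symmetric] by blast
qed

definition choose_problem :: "nat \<Rightarrow> (baire, baire) problem" where
  "choose_problem m = (Some, Some, \<lambda>r. {pair_b r s |s. s 0 \<in> candidates m r})"

text \<open>The pairing of instance and answer handed to the outer functional is already a solution,
  so the identity works.\<close>

lemma choose_problem_le: "choose_problem m \<le>\<^sub>W C_N"
proof (rule W_leI[OF computable_pf_id computable_pf_refutations])
  show "reduces Some (\<lambda>r. Some (refutations m r)) (choose_problem m) C_N"
    by (auto simp: reduces_def choose_problem_def C_N_def delta_compl_enum_def delta_nat_def candidates_def)
qed

text \<open>For \<open>q = \<langle>r, s\<rangle>\<close> with \<open>s 0 = \<langle>N, bl_code w\<rangle>\<close>, the word \<open>w\<close> and the name of the subtree at \<open>w\<close> of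
  the \<open>N\<close>-th tree of \<open>r\<close>.\<close>

definition chosen_code :: "baire \<Rightarrow> nat" where
  "chosen_code q = snd (prod_decode (q 1))"

definition chosen_word :: "baire \<Rightarrow> bool list" where
  "chosen_word q = inv bl_code (chosen_code q)"

definition chosen_name :: "baire \<Rightarrow> baire" where
  "chosen_name q = (\<lambda>j. q (2 * prod_encode (fst (prod_decode (q 1)),
     chosen_code q + 2 ^ code_length (chosen_code q) * j)))"

lemma bl_code_chosen_word: "bl_code (chosen_word q) = chosen_code q"
  unfolding chosen_word_def by (rule f_inv_into_f) (metis bl_code_surj rangeI)

text \<open>On Baire space with the identity representation the solutions are themselves names, so
  \<open>delta_Tr\<close> and \<open>delta_Cantor\<close> move into the solution set.\<close>

definition path_problem :: "real \<Rightarrow> (baire, baire) problem" where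
  "path_problem \<epsilon> = (Some, Some, \<lambda>q. {y. \<exists>T x. delta_Tr (chosen_name q) = Some T \<and>
     \<epsilon> < measure mu_Cantor (paths T) \<and> x \<in> paths T \<and> delta_Cantor y = Some (append_seq (chosen_word q) x)})"

text \<open>Here \<open>z\<close> pairs \<open>q\<close> with a path name, so \<open>z 2\<close> is
  \<open>q 1\<close>, the number that carries the word, and the path sits at the odd
  positions.\<close>

definition prepend_chosen :: "baire \<Rightarrow> baire" where
  "prepend_chosen z n = (let a = snd (prod_decode (z 2)) in
     if n < code_length a then (if even (shift_code a n) then 1 else 0)
     else z (Suc (2 * (n - code_length a))))"

lemma computable_pf_chosen_name: "computable_pf (\<lambda>q. Some (chosen_name q))"
proof (rule computable_pfI)
  let ?s = "\<lambda>x :: nat \<times> nat list. prod_decode (look (snd x) 1 - 1)"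
  let ?\<phi> = "\<lambda>x. if length (snd x) \<le> 1 then 0 else
    look (snd x) (2 * prod_encode (fst (?s x), snd (?s x) + 2 ^ code_length (snd (?s x)) * fst x))"
  show "computable ?\<phi>" by (intro comp_intro)
  fix p q n assume "Some (chosen_name p) = Some q"
  then have q: "q = chosen_name p" by simp
  let ?i = "2 * prod_encode (fst (prod_decode (p 1)), chosen_code p + 2 ^ code_length (chosen_code p) * n)"
  have val: "?\<phi> (n, pref p k) = (if k \<le> 1 then 0 else if ?i < k then Suc (q n) else 0)" for k
    by (simp add: look_pref q chosen_name_def chosen_code_def)
  show "\<exists>k. 0 < ?\<phi> (n, pref p k)" unfolding val by (rule exI[of _ "?i + 2"]) simp
  show "?\<phi> (n, pref p k) = Suc (q n)" if "0 < ?\<phi> (n, pref p k)" for k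
    using that unfolding val by (simp split: if_splits)
qed

lemma computable_pf_prepend_chosen: "computable_pf (\<lambda>z. Some (prepend_chosen z))"
proof (rule computable_pfI)
  let ?a = "\<lambda>x :: nat \<times> nat list. snd (prod_decode (look (snd x) 2 - 1))"
  let ?\<phi> = "\<lambda>x. if length (snd x) \<le> 2 then 0 else
    if fst x < code_length (?a x) then (if even (shift_code (?a x) (fst x)) then 2 else 1)
    else look (snd x) (Suc (2 * (fst x - code_length (?a x))))"
  show "computable ?\<phi>" by (intro comp_intro)
  fix p q n assume "Some (prepend_chosen p) = Some q"
  then have q: "q = prepend_chosen p" by simp
  let ?i = "Suc (2 * (n - code_length (snd (prod_decode (p 2)))))"
  have val: "?\<phi> (n, pref p k) = (if k \<le> 2 then 0 else
      if n < code_length (snd (prod_decode (p 2))) \<or> ?i < k then Suc (q n) else 0)" for k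
    by (simp add: look_pref q prepend_chosen_def Let_def)
  show "\<exists>k. 0 < ?\<phi> (n, pref p k)" unfolding val by (rule exI[of _ "?i + 3"]) simp
  show "?\<phi> (n, pref p k) = Suc (q n)" if "0 < ?\<phi> (n, pref p k)" for k
    using that unfolding val by (simp split: if_splits)
qed

lemma delta_Cantor_prepend_chosen:
  assumes "delta_Cantor y = Some x"
  shows "delta_Cantor (prepend_chosen (pair_b q y)) = Some (append_seq (chosen_word q) x)"
proof -
  note y = delta_CantorD[OF assms]
  have a: "snd (prod_decode (pair_b q y 2)) = bl_code (chosen_word q)"
    using pair_b_simps(1)[of q y 1] by (simp add: bl_code_chosen_word chosen_code_def)
  have val: "prepend_chosen (pair_b q y) n = (if n < length (chosen_word q)
      then of_bool (chosen_word q ! n) else y (n - length (chosen_word q)))" for n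
    by (simp add: prepend_chosen_def a code_length code_bit)
  have "prepend_chosen (pair_b q y) n \<le> 1" for n using y by (auto simp: val)
  moreover have "(\<lambda>n. prepend_chosen (pair_b q y) n = 1) = append_seq (chosen_word q) x"
    using y by (auto simp: val append_seq_def)
  ultimately show ?thesis unfolding delta_Cantor_def by simp
qed

lemma path_problem_le: "path_problem \<epsilon> \<le>\<^sub>W eps_WWKL \<epsilon>"
proof (rule W_leI[OF computable_pf_prepend_chosen computable_pf_chosen_name])
  show "reduces (\<lambda>z. Some (prepend_chosen z)) (\<lambda>q. Some (chosen_name q)) (path_problem \<epsilon>) (eps_WWKL \<epsilon>)"
    unfolding reduces_def
  proof (intro allI impI, elim conjE)
    fix q x assume "fst (path_problem \<epsilon>) q = Some x" "snd (snd (path_problem \<epsilon>)) x \<noteq> {}"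
    then obtain T x' where x: "x = q" and T: "delta_Tr (chosen_name q) = Some T" "\<epsilon> < measure mu_Cantor (paths T)"
      and x': "x' \<in> paths T" by (auto simp: path_problem_def)
    have "prepend_chosen (pair_b q r) \<in> snd (snd (path_problem \<epsilon>)) q"
      if "delta_Cantor r = Some y" "y \<in> paths T" for r y
      using that T delta_Cantor_prepend_chosen[OF that(1), of q] by (auto simp: path_problem_def)
    then show "\<exists>k z. Some (chosen_name q) = Some k \<and> fst (eps_WWKL \<epsilon>) k = Some z \<and>
       snd (snd (eps_WWKL \<epsilon>)) z \<noteq> {} \<and>
       (\<forall>r y. fst (snd (eps_WWKL \<epsilon>)) r = Some y \<and> y \<in> snd (snd (eps_WWKL \<epsilon>)) z \<longrightarrow>
          (\<exists>s v. Some (prepend_chosen (pair_b q r)) = Some s \<and> fst (snd (path_problem \<epsilon>)) s = Some v \<and>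
            v \<in> snd (snd (path_problem \<epsilon>)) x))"
      using T x' x by (intro exI[of _ "chosen_name q"] exI[of _ T]) (auto simp: eps_WWKL_def path_problem_def)
  qed
qed

section \<open>Correctness of the candidates\<close>

lemma chosen_pair:
  assumes "s 0 = prod_encode (N, bl_code w)"
  shows "chosen_word (pair_b r s) = w"
    "chosen_name (pair_b r s) = (\<lambda>j. seq_of r N (bl_code w + 2 ^ length w * j))"
proof -
  have "pair_b r s 1 = s 0" using pair_b_simps(2)[of r s 0] by simp
  then have "prod_decode (pair_b r s 1) = (N, bl_code w)" using assms by simp
  then show "chosen_word (pair_b r s) = w"
    "chosen_name (pair_b r s) = (\<lambda>j. seq_of r N (bl_code w + 2 ^ length w * j))"
    by (simp_all add: chosen_word_def chosen_name_def chosen_code_def seq_of_def code_length inv_f_f[OF inj_bl_code])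
qed

text \<open>Stabilisation from \<open>N\<close> on identifies entry \<open>N\<close> with the limit,
  so the counting bounds concern \<open>T\<close> itself, and \<open>measure_paths_ge\<close> turns
  them into a measure.\<close>

lemma candidate_subtree:
  assumes t: "lim_Delta r = Some t" "delta_Tr t = Some T" and s: "s 0 \<in> candidates m r"
  obtains w where "chosen_word (pair_b r s) = w" "is_tree T"
    "delta_Tr (chosen_name (pair_b r s)) = Some (subtree w T)"
    "1 - (1 / 2) ^ m \<le> measure mu_Cantor (paths (subtree w T))"
proof -
  note T = delta_TrD[OF t(2)]
  obtain N a where "prod_decode (s 0) = (N, a)" by (cases "prod_decode (s 0)")
  moreover obtain w where "bl_code w = a" using bl_code_surj by blast
  ultimately have s0: "s 0 = prod_encode (N, bl_code w)" by (metis prod_decode_inverse)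
  from s[unfolded s0 candidates_iff] have const: "\<And>i. N \<le> i \<Longrightarrow> seq_of r i = seq_of r N"
    and miss: "\<And>l. 2 ^ m * missing (seq_of r N) w l \<le> 2 ^ l" by blast+
  from lim_Delta_eqI[OF const] t(1) have N: "seq_of r N = t" by simp
  note miss = miss[unfolded N]
  have tree: "is_tree (subtree w T)" using T is_tree_subtree by blast
  have "delta_Tr (chosen_name (pair_b r s)) = Some (subtree w T)"
    unfolding chosen_pair[of s N w, OF s0] N
    by (rule delta_TrI) (use T tree in \<open>auto simp: subtree_def bl_code_append\<close>)
  moreover have "1 - (1 / 2) ^ m \<le> measure mu_Cantor (paths (subtree w T))"
  proof (rule measure_paths_ge[OF tree])
    show "(1 - (1 / 2) ^ m) * 2 ^ l \<le> real (card (level (subtree w T) l))" for l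
      using miss[of l] missing_le_iff[of t T m w l] T by blast
  qed
  ultimately show thesis using that chosen_pair(1)[of s N w, OF s0] T by blast
qed

text \<open>A stabilisation point of the sequence, paired with a node from
  \<open>dense_subtree\<close> for the density \<open>1 - (1 / 2) ^ m\<close>, is never
  refuted.\<close>

lemma candidates_nonempty:
  assumes t: "lim_Delta r = Some t" "delta_Tr t = Some T" and pos: "0 < measure mu_Cantor (paths T)"
  shows "candidates m r \<noteq> {}"
proof -
  note T = delta_TrD[OF t(2)]
  obtain N where N: "\<And>i. N \<le> i \<Longrightarrow> seq_of r i = t" using lim_DeltaE[OF t(1)] by blast
  have "1 - (1 / 2) ^ m < (1 :: real)" by simp
  then obtain w where w: "\<And>l. (1 - (1 / 2) ^ m) * 2 ^ l \<le> real (card (level (subtree w T) l))"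
    using dense_subtree[of T "1 - (1 / 2) ^ m"] T pos by blast
  have "2 ^ m * missing t w l \<le> 2 ^ l" for l
    using w[of l] missing_le_iff[of t T m w l] T by blast
  then have "prod_encode (N, bl_code w) \<in> candidates m r"
    unfolding candidates_iff using N by simp
  then show ?thesis by blast
qed

text \<open>The composition already outputs names of paths through \<open>T\<close>, so the inner
  functional is the identity and the outer one merely drops the instance.\<close>

lemma djump_WWKL_le_comp:
  assumes "0 \<le> \<epsilon>" and m: "\<epsilon> < 1 - (1 / 2) ^ m"
  shows "djump WWKL \<le>\<^sub>W comp_problem (path_problem \<epsilon>) (choose_problem m)"
proof (rule W_leI[OF computable_pf_snd computable_pf_id])
  let ?C = "comp_problem (path_problem \<epsilon>) (choose_problem m)"
  show "reduces (\<lambda>z. Some (\<lambda>n. z (Suc (2 * n)))) Some (djump WWKL) ?C"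
    unfolding reduces_def
  proof (intro allI impI, elim conjE)
    fix r T assume "fst (djump WWKL) r = Some T" "snd (snd (djump WWKL)) T \<noteq> {}"
    then obtain t where t: "lim_Delta r = Some t" "delta_Tr t = Some T" and pos: "0 < measure mu_Cantor (paths T)"
      by (auto simp: djump_def WWKL_def bind_eq_Some_conv split: if_splits)
    let ?f = "snd (snd (path_problem \<epsilon>))" and ?g = "snd (snd (choose_problem m))"
    \<comment> \<open>A composition is defined only where every intermediate solution lies in the
      domain of the second problem, so every candidate must be good, not only the intended
      one.\<close>
    have *: "?f q \<noteq> {} \<and> (\<forall>y\<in>?f q. \<exists>x\<in>paths T. delta_Cantor y = Some x)" if "q \<in> ?g r" for q
    proof -
      from that obtain s where q: "q = pair_b r s" "s 0 \<in> candidates m r" by (auto simp: choose_problem_def)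
      obtain w where w: "chosen_word q = w" "is_tree T" "delta_Tr (chosen_name q) = Some (subtree w T)"
        "1 - (1 / 2) ^ m \<le> measure mu_Cantor (paths (subtree w T))"
        unfolding q(1) by (rule candidate_subtree[OF t, where s = s, OF q(2)])
      from w(4) m \<open>0 \<le> \<epsilon>\<close> have big: "\<epsilon> < measure mu_Cantor (paths (subtree w T))" by linarith
      with \<open>0 \<le> \<epsilon>\<close> have "paths (subtree w T) \<noteq> {}" by auto
      then obtain x where x: "x \<in> paths (subtree w T)" by blast
      obtain y where "delta_Cantor y = Some (append_seq w x)" using delta_Cantor_surj by blast
      then have "y \<in> ?f q" using x w big by (auto simp: path_problem_def)
      moreover have "\<exists>x\<in>paths T. delta_Cantor y = Some x" if "y \<in> ?f q" for y
        using that w(1,3) append_seq_in_paths[OF w(2)] by (auto simp: path_problem_def)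
      ultimately show ?thesis by blast
    qed
    obtain n where "n \<in> candidates m r" using candidates_nonempty[OF t pos] by blast
    then have "pair_b r (\<lambda>_. n) \<in> ?g r" by (auto simp: choose_problem_def)
    then have ne: "mv_comp ?f ?g r \<noteq> {}" using * by (auto simp: mv_comp_def)
    have "\<exists>v. delta_Cantor y = Some v \<and> v \<in> paths T" if "y \<in> mv_comp ?f ?g r" for y
      using that * by (fastforce simp: mv_comp_def split: if_splits)
    then show "\<exists>k z. Some r = Some k \<and> fst ?C k = Some z \<and> snd (snd ?C) z \<noteq> {} \<and>
       (\<forall>q y. fst (snd ?C) q = Some y \<and> y \<in> snd (snd ?C) z \<longrightarrow>
          (\<exists>s v. Some (\<lambda>n. pair_b r q (Suc (2 * n))) = Some s \<and> fst (snd (djump WWKL)) s = Some v \<and>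
            v \<in> snd (snd (djump WWKL)) T))"
      using ne pos by (intro exI[of _ r])
        (auto simp: comp_problem_def choose_problem_def path_problem_def djump_def WWKL_def)
  qed
qed

theorem theorem11p4:
  fixes \<epsilon> :: real
  assumes "0 \<le> \<epsilon>" and "\<epsilon> < 1"
  shows "W_eq_comp_prod (djump WWKL) (eps_WWKL \<epsilon>) C_N TYPE('u) TYPE('x) TYPE('y)"
proof -
  obtain m where m: "(1 / 2) ^ m < 1 - \<epsilon>"
    using real_arch_pow_inv[of "1 - \<epsilon>" "1 / 2"] assms(2) by auto
  have "is_problem (path_problem \<epsilon>)" "is_problem (choose_problem m)"
    "composable (path_problem \<epsilon>) (choose_problem m)"
    by (auto simp: is_problem_def rep_space_def path_problem_def choose_problem_def composable_def)
  moreover have "djump WWKL \<le>\<^sub>W comp_problem (path_problem \<epsilon>) (choose_problem m)"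
    using m by (intro djump_WWKL_le_comp[OF assms(1)]) simp
  ultimately show ?thesis
    unfolding W_eq_comp_prod_def
    using comp_le_djump_WWKL[OF _ _ _ assms(1)] path_problem_le choose_problem_le by blast
qed

end
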